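(* Let $n$ be a positive integer, let $N$ be an $n$-dimensional $C^\infty$ manifold without boundary, and let $\widetilde{\varphi}: N\to\mathbb{R}^{n+1}$ and $\widetilde{\nu}: N\to S^n$ be $C^\infty$ mappings. Then the hyperplane family $\mathcal{H}_{(\widetilde{\varphi},\widetilde{\nu})}$ creates a unique envelope if and only if it is creative and the set consisting of regular points of $\widetilde{\nu}$ is dense in $N$.
   Context: All manifolds, functions and mappings are of class $C^\infty$. $S^n$ is the unit sphere in $\mathbb{R}^{n+1}$ and $\cdot$ is the standard scalar product. Hyperplane family: for $P\in\mathbb{R}^{n+1}$ and $\mathbf{n}\in S^n$ let $H_{(P,\mathbf{n})}=\{X\in\mathbb{R}^{n+1} : (X-P)\cdot\mathbf{n}=0\}$. The hyperplane family relative to $\widetilde{\varphi}$ and $\widetilde{\nu}$ is $\mathcal{H}_{(\widetilde{\varphi},\widetilde{\nu})}=\{H_{(\widetilde{\varphi}(x),\widetilde{\nu}(x))}\}_{x\in N}$. Envelope: a $C^\infty$ mapping $\widetilde{f}: N\to\mathbb{R}^{n+1}$ is an envelope created by $\mathcal{H}_{(\widetilde{\varphi},\widetilde{\nu})}$ if (a) $\widetilde{f}(x)\in H_{(\widetilde{\varphi}(x),\widetilde{\nu}(x))}$ for all $x\in N$, and (b) $d\widetilde{f}_x(\mathbf{v})\cdot\widetilde{\nu}(x)=0$ for all $x\in N$ and $\mathbf{v}\in T_xN$. The family creates a unique envelope if there is exactly one such mapping $\widetilde{f}$. Creative: set $\widetilde{\gamma}(x)=\widetilde{\varphi}(x)\cdot\widetilde{\nu}(x)$.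 The family $\mathcal{H}_{(\widetilde{\varphi},\widetilde{\nu})}$ is creative if there is a $C^\infty$ mapping $\widetilde{\Omega}: N\to T^*S^n$ of the form $\widetilde{\Omega}(x)=(\widetilde{\nu}(x),\widetilde{\omega}(x))$, with $\widetilde{\omega}(x)\in T^*_{\widetilde{\nu}(x)}S^n$, such that $d\widetilde{\gamma}=\widetilde{\omega}$ as 1-forms on $N$, meaning $d\widetilde{\gamma}_x(\mathbf{v})=\widetilde{\omega}(x)\big(d\widetilde{\nu}_x(\mathbf{v})\big)$ for all $x\in N$, $\mathbf{v}\in T_xN$. A point $x\in N$ is a regular point of $\widetilde{\nu}$ if $d\widetilde{\nu}_x: T_xN\to T_{\widetilde{\nu}(x)}S^n$ has rank $n$. *)

theory Defs
  imports "HOL-Analysis.Analysis"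
begin

text \<open>Smoothness on open subsets of normed spaces. Both notions are used on open sets only.\<close>

primrec Ck_on :: "nat \<Rightarrow> 'a::real_normed_vector set \<Rightarrow> ('a \<Rightarrow> 'b::real_normed_vector) \<Rightarrow> bool" where
  "Ck_on 0 S f \<longleftrightarrow> continuous_on S f"
| "Ck_on (Suc k) S f \<longleftrightarrow>
     (\<forall>x\<in>S. f differentiable (at x)) \<and> (\<forall>v. Ck_on k S (\<lambda>x. frechet_derivative f (at x) v))"

definition smooth_on :: "'a::real_normed_vector set \<Rightarrow> ('a \<Rightarrow> 'b::real_normed_vector) \<Rightarrow> bool" where
  "smooth_on S f \<longleftrightarrow> (\<forall>k. Ck_on k S f)"

text \<open>A chart is a pair of its domain and its coordinate map; the values of the coordinate map
  outside the domain are irrelevant.\<close>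

type_synonym ('a, 'e) chart = "'a set \<times> ('a \<Rightarrow> 'e)"

abbreviation dom_of :: "('a, 'e) chart \<Rightarrow> 'a set" where
  "dom_of \<equiv> fst"

abbreviation coord :: "('a, 'e) chart \<Rightarrow> 'a \<Rightarrow> 'e" where
  "coord \<equiv> snd"

definition param :: "('a, 'e) chart \<Rightarrow> 'e \<Rightarrow> 'a" where
  "param \<kappa> = inv_into (dom_of \<kappa>) (coord \<kappa>)"

definition is_chart :: "'a topology \<Rightarrow> ('a, 'e::euclidean_space) chart \<Rightarrow> bool" where
  "is_chart X \<kappa> \<longleftrightarrow>
     openin X (dom_of \<kappa>) \<and> open (coord \<kappa> ` dom_of \<kappa>) \<and>
     homeomorphic_map (subtopology X (dom_of \<kappa>)) (top_of_set (coord \<kappa> ` dom_of \<kappa>)) (coord \<kappa>)"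

text \<open>The atlas need not be maximal: a smooth structure is given by any atlas that generates it,
  and the notions below depend only on the smooth structure. The empty manifold is allowed.\<close>

definition smooth_manifold :: "'a topology \<Rightarrow> ('a, 'e::euclidean_space) chart set \<Rightarrow> bool" where
  "smooth_manifold X A \<longleftrightarrow>
     Hausdorff_space X \<and> second_countable X \<and>
     (\<forall>\<kappa>\<in>A. is_chart X \<kappa>) \<and> \<Union>(dom_of ` A) = topspace X \<and>
     (\<forall>\<kappa>\<in>A. \<forall>\<kappa>'\<in>A. smooth_on (coord \<kappa> ` (dom_of \<kappa> \<inter> dom_of \<kappa>')) (coord \<kappa>' \<circ> param \<kappa>))"

text \<open>As \<open>A\<close> need not be closed under restriction of charts, one has to shrink the domain of the
  chart around \<open>x\<close>.\<close>

definition smooth_map ::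
  "'a topology \<Rightarrow> ('a, 'e::euclidean_space) chart set \<Rightarrow> ('b, 'f::euclidean_space) chart set
    \<Rightarrow> ('a \<Rightarrow> 'b) \<Rightarrow> bool" where
  "smooth_map X A B f \<longleftrightarrow>
     (\<forall>x\<in>topspace X. \<exists>\<kappa>\<in>A. \<exists>\<beta>\<in>B. \<exists>U.
        openin X U \<and> x \<in> U \<and> U \<subseteq> dom_of \<kappa> \<and> f ` U \<subseteq> dom_of \<beta> \<and>
        smooth_on (coord \<kappa> ` U) (coord \<beta> \<circ> f \<circ> param \<kappa>))"

definition std_atlas :: "('e::euclidean_space, 'e) chart set" where
  "std_atlas = {(UNIV, \<lambda>x. x)}"

text \<open>A tangent vector at \<open>x\<close> assigns to every chart around \<open>x\<close> its components in that chart, which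
  transform by the derivative of the change of coordinates.\<close>

definition charts_at :: "('a, 'e) chart set \<Rightarrow> 'a \<Rightarrow> ('a, 'e) chart set" where
  "charts_at A x = {\<kappa>\<in>A. x \<in> dom_of \<kappa>}"

definition tangent_space ::
  "('a, 'e::euclidean_space) chart set \<Rightarrow> 'a \<Rightarrow> (('a, 'e) chart \<Rightarrow> 'e) set" where
  "tangent_space A x =
     {v \<in> extensional (charts_at A x).
        \<forall>\<kappa>\<in>charts_at A x. \<forall>\<kappa>'\<in>charts_at A x.
          v \<kappa>' = frechet_derivative (coord \<kappa>' \<circ> param \<kappa>) (at (coord \<kappa> x)) (v \<kappa>)}"

text \<open>The differential at \<open>x\<close> of a map into a normed space. By the chain rule it does not depend on
  the chosen chart around \<open>x\<close>.\<close>

definition differential ::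
  "('a, 'e::euclidean_space) chart set \<Rightarrow> 'a \<Rightarrow> ('a \<Rightarrow> 'b::real_normed_vector)
    \<Rightarrow> (('a, 'e) chart \<Rightarrow> 'e) \<Rightarrow> 'b" where
  "differential A x f v =
     (let \<kappa> = (SOME \<kappa>. \<kappa> \<in> charts_at A x)
      in frechet_derivative (f \<circ> param \<kappa>) (at (coord \<kappa> x)) (v \<kappa>))"

text \<open>The unit sphere with the smooth structure of an embedded submanifold: its charts are the
  inverses of the regular parametrizations of its open subsets. For \<open>CARD('m) = CARD('n) + 1\<close> this is
  the maximal atlas of the sphere; for other dimensions it is not an atlas of the sphere.\<close>

definition sphere_atlas :: "(real^'m, real^'n) chart set" where
  "sphere_atlas =
     {\<kappa>. is_chart (top_of_set (sphere 0 1)) \<kappa> \<and>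
         smooth_on (coord \<kappa> ` dom_of \<kappa>) (param \<kappa>) \<and>
         (\<forall>y\<in>coord \<kappa> ` dom_of \<kappa>. inj (frechet_derivative (param \<kappa>) (at y)))}"

text \<open>The tangent space of the sphere at \<open>p\<close>, identified as usual with a subspace of the ambient
  space, and its dual. Functionals are undefined off the tangent space, so that equality of
  functionals is equality of functions.\<close>

definition sphere_tangent :: "real^'m \<Rightarrow> (real^'m) set" where
  "sphere_tangent p = {w. w \<bullet> p = 0}"

definition sphere_cotangent :: "real^'m \<Rightarrow> (real^'m \<Rightarrow> real) set" where
  "sphere_cotangent p =
     {\<alpha> \<in> extensional (sphere_tangent p).
        (\<forall>v\<in>sphere_tangent p. \<forall>w\<in>sphere_tangent p. \<alpha> (v + w) = \<alpha> v + \<alpha> w) \<and>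
        (\<forall>c. \<forall>v\<in>sphere_tangent p. \<alpha> (c *\<^sub>R v) = c * \<alpha> v)}"

text \<open>The cotangent bundle of the sphere, with its points written as pairs \<open>(p, \<alpha>)\<close>. A chart
  \<open>\<kappa>\<close> of the sphere induces the chart sending \<open>(p, \<alpha>)\<close> to the coordinates of \<open>p\<close> and the components
  of \<open>\<alpha>\<close> with respect to the coordinate coframe, that is, the values of \<open>\<alpha>\<close> on the coordinate
  vectors \<open>\<partial>/\<partial>y\<^sub>i\<close> at \<open>p\<close>.\<close>

definition cotangent_chart ::
  "(real^'m, real^'n) chart \<Rightarrow> ((real^'m) \<times> (real^'m \<Rightarrow> real), (real^'n) \<times> (real^'n)) chart" where
  "cotangent_chart \<kappa> =
     ({(p, \<alpha>). p \<in> dom_of \<kappa> \<and> \<alpha> \<in> sphere_cotangent p},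
      \<lambda>(p, \<alpha>). (coord \<kappa> p,
                \<chi> i. \<alpha> (frechet_derivative (param \<kappa>) (at (coord \<kappa> p)) (axis i 1))))"

definition sphere_cotangent_atlas ::
  "((real^'m) \<times> (real^'m \<Rightarrow> real), (real^'n) \<times> (real^'n)) chart set" where
  "sphere_cotangent_atlas = cotangent_chart ` sphere_atlas"

definition hyperplane :: "real^'m \<Rightarrow> real^'m \<Rightarrow> (real^'m) set" where
  "hyperplane P \<eta> = {Y. (Y - P) \<bullet> \<eta> = 0}"

text \<open>The hyperplane family is represented by the pair of maps \<open>\<phi>\<close>, \<open>\<nu>\<close>. Maps on the manifold are
  undefined off \<open>topspace X\<close>, so that uniqueness of an envelope is uniqueness as a map on the
  manifold.\<close>

definition is_envelope ::
  "'a topology \<Rightarrow> ('a, real^'n) chart set \<Rightarrow> ('a \<Rightarrow> real^'m) \<Rightarrow> ('a \<Rightarrow> real^'m)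
    \<Rightarrow> ('a \<Rightarrow> real^'m) \<Rightarrow> bool" where
  "is_envelope X A \<phi> \<nu> f \<longleftrightarrow>
     f \<in> extensional (topspace X) \<and> smooth_map X A std_atlas f \<and>
     (\<forall>x\<in>topspace X. f x \<in> hyperplane (\<phi> x) (\<nu> x)) \<and>
     (\<forall>x\<in>topspace X. \<forall>v\<in>tangent_space A x. differential A x f v \<bullet> \<nu> x = 0)"

definition creates_unique_envelope ::
  "'a topology \<Rightarrow> ('a, real^'n) chart set \<Rightarrow> ('a \<Rightarrow> real^'m) \<Rightarrow> ('a \<Rightarrow> real^'m) \<Rightarrow> bool" where
  "creates_unique_envelope X A \<phi> \<nu> \<longleftrightarrow> (\<exists>!f. is_envelope X A \<phi> \<nu> f)"

definition creative ::
  "'a topology \<Rightarrow> ('a, real^'n) chart set \<Rightarrow> ('a \<Rightarrow> real^'m) \<Rightarrow> ('a \<Rightarrow> real^'m) \<Rightarrow> bool" where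
  "creative X A \<phi> \<nu> \<longleftrightarrow>
     (\<exists>\<omega> :: 'a \<Rightarrow> real^'m \<Rightarrow> real.
        (\<forall>x\<in>topspace X. \<omega> x \<in> sphere_cotangent (\<nu> x)) \<and>
        smooth_map X A
          (sphere_cotangent_atlas ::
            ((real^'m) \<times> (real^'m \<Rightarrow> real), (real^'n) \<times> (real^'n)) chart set)
          (\<lambda>x. (\<nu> x, \<omega> x)) \<and>
        (\<forall>x\<in>topspace X. \<forall>v\<in>tangent_space A x.
           differential A x (\<lambda>y. \<phi> y \<bullet> \<nu> y) v = \<omega> x (differential A x \<nu> v)))"

definition regular_point ::
  "('a, real^'n) chart set \<Rightarrow> ('a \<Rightarrow> real^'m) \<Rightarrow> 'a \<Rightarrow> bool" where
  "regular_point A \<nu> x \<longleftrightarrow> dim (differential A x \<nu> ` tangent_space A x) = CARD('n)"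

end

theory Submission
  imports Defs "HOL-Computational_Algebra.Polynomial"
begin

text \<open>
  Write \<open>\<gamma> = \<phi> \<bullet> \<nu>\<close>. Differentiating \<open>f \<bullet> \<nu> = \<gamma>\<close> shows that \<open>f\<close> is an envelope iff
  \<open>f \<bullet> \<nu> = \<gamma>\<close> and \<open>d\<gamma> = f \<bullet> d\<nu>\<close>. So the restriction of \<open>f\<close> to the tangent space of the sphere at
  \<open>\<nu>\<close> is a creating form \<open>\<omega>\<close>, and conversely \<open>\<gamma>\<close> and \<open>\<omega>\<close> are the normal and the tangential
  components of an envelope. Two envelopes differ by a smooth map that is orthogonal to \<open>\<nu>\<close> and to the
  image of \<open>d\<nu>\<close>; it vanishes at regular points, hence everywhere if these are dense. If they are not
  dense, \<open>\<nu>\<close> and \<open>d\<nu>\<close> fail to span the ambient space throughout some open set, cofactors give a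
  nonzero smooth map there orthogonal to all of them, and a bump function extends it to the manifold.
\<close>

section \<open>Calculus of smooth maps\<close>

text \<open>As \<open>\<nu>\<close> has unit length, the values of its derivative are orthogonal to
  \<open>\<nu>\<close>. Rank n therefore means the same as: \<open>\<nu>\<close> and the image of
  its derivative span the ambient space of dimension n + 1. At a point that is not regular, the
  creative equation fixes \<open>\<omega>\<close> only on a proper subspace of the tangent space, so
  a smooth choice of \<open>\<omega>\<close> is a genuine condition; each envelope amounts to one
  such choice. The obstacle in the non-dense case is that the rank of the derivative may jump, so
  that the vectors orthogonal to \<open>\<nu>\<close> and to this image need not form a bundle. A
  pointwise choice could not be made smooth; counting the varying rows of a determinant and
  maximizing their number avoids any assumption of constant rank. Tangent vectors and
  \<open>differential\<close> refer to all charts at a point and to a selected one. The arguments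
  run instead on \<open>chart_deriv\<close>, the derivative in an arbitrary chart of the
  atlas.\<close>

lemma Ck_on_subset: "Ck_on k S f \<Longrightarrow> T \<subseteq> S \<Longrightarrow> Ck_on k T f"
  by (induction k arbitrary: f) (auto intro: continuous_on_subset)

lemma Ck_on_has_derivative:
  "Ck_on (Suc k) S f \<Longrightarrow> x \<in> S \<Longrightarrow> (f has_derivative frechet_derivative f (at x)) (at x)"
  by (rule frechet_derivative_works[THEN iffD1]) simp

lemma Ck_on_cong:
  assumes "open S" "\<And>x. x \<in> S \<Longrightarrow> f x = g x" "Ck_on k S f"
  shows "Ck_on k S g"
  using assms(2,3)
proof (induction k arbitrary: f g)
  case 0
  then show ?case
    by (metis Ck_on.simps(1) continuous_on_cong)
next
  case (Suc k)
  have d: "(g has_derivative frechet_derivative f (at x)) (at x)" if "x \<in> S" for x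
    by (rule has_derivative_transform_within_open[OF Ck_on_has_derivative[OF Suc.prems(2) that] assms(1) that])
      (rule Suc.prems(1))
  then have "\<forall>x\<in>S. g differentiable (at x)"
    unfolding differentiable_def by blast
  moreover have "frechet_derivative f (at x) = frechet_derivative g (at x)" if "x \<in> S" for x
    using d[OF that] by (rule frechet_derivative_at)
  then have "\<forall>v. Ck_on k S (\<lambda>x. frechet_derivative g (at x) v)"
    using Suc.prems(2) Suc.IH[of "\<lambda>x. frechet_derivative f (at x) _"] by simp
  ultimately show ?case
    unfolding Ck_on.simps by (rule conjI)
qed

text \<open>\<open>Ck_on\<close> is phrased with the choice operator
  \<open>frechet_derivative\<close>. This rule accepts any explicit derivative formula in its place,
  and the closure properties below are inductions through it.\<close>

lemma Ck_on_SucI: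
  assumes "open S" "\<And>x. x \<in> S \<Longrightarrow> (f has_derivative f' x) (at x)"
    and "\<And>v. Ck_on k S (\<lambda>x. f' x v)"
  shows "Ck_on (Suc k) S f"
proof -
  have "f' x = frechet_derivative f (at x)" if "x \<in> S" for x
    using assms(2)[OF that] by (rule frechet_derivative_at)
  then have "Ck_on k S (\<lambda>x. frechet_derivative f (at x) v)" for v
    using assms(1) by (intro Ck_on_cong[OF _ _ assms(3)[of v]]) auto
  then show ?thesis
    using assms(2) by (auto simp: differentiable_def)
qed

text \<open>The recursion mentions lower orders only for the derivatives. The product and chain
  rules keep undifferentiated factors as well, and these have to descend by one order.\<close>

lemma Ck_on_Suc_imp: "Ck_on (Suc k) S f \<Longrightarrow> Ck_on k S f"
proof (induction k arbitrary: f)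
  case 0
  then have "f differentiable_on S"
    by (simp add: differentiable_at_imp_differentiable_on)
  then show ?case
    by (simp add: differentiable_imp_continuous_on)
next
  case (Suc k)
  note * = Suc.prems[unfolded Ck_on.simps(2)[of "Suc k"]]
  have "\<forall>v. Ck_on k S (\<lambda>x. frechet_derivative f (at x) v)"
    using * Suc.IH by blast
  then show ?case
    using * unfolding Ck_on.simps(2)[of k] by (intro conjI) (rule conjunct1)
qed

lemma Ck_on_locally:
  assumes "\<And>x. x \<in> S \<Longrightarrow> \<exists>T. open T \<and> x \<in> T \<and> Ck_on k T f"
  shows "Ck_on k S f"
  using assms
proof (induction k arbitrary: f)
  case 0
  have "isCont f x" if "x \<in> S" for x
    using 0[OF that] by (auto simp: continuous_on_eq_continuous_at)
  then show ?case
    by (auto intro: continuous_at_imp_continuous_on)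
next
  case (Suc k)
  show ?case
    unfolding Ck_on.simps
  proof (intro conjI allI ballI)
    fix x assume "x \<in> S"
    then show "f differentiable (at x)"
      using Suc.prems[of x] by auto
  next
    fix v
    show "Ck_on k S (\<lambda>x. frechet_derivative f (at x) v)"
      proof (rule Suc.IH)
      fix x assume "x \<in> S"
      then obtain T where "open T" "x \<in> T" "Ck_on (Suc k) T f"
        using Suc.prems by blast
      then show "\<exists>T. open T \<and> x \<in> T \<and> Ck_on k T (\<lambda>x. frechet_derivative f (at x) v)"
        by auto
    qed
  qed
qed

lemma Ck_on_const: "Ck_on k S (\<lambda>x. c)"
  by (induction k arbitrary: c) auto

lemma Ck_on_bounded_linear:
  assumes L: "bounded_linear L" and "open S" "Ck_on k S f"
  shows "Ck_on k S (\<lambda>x. L (f x))"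
  using assms(3)
proof (induction k arbitrary: f)
  case 0
  then show ?case
    by (auto intro: bounded_linear.continuous_on[OF L])
next
  case (Suc k)
  show ?case
  proof (rule Ck_on_SucI[OF assms(2)])
    show "((\<lambda>x. L (f x)) has_derivative (\<lambda>v. L (frechet_derivative f (at x) v))) (at x)"
      if "x \<in> S" for x
      by (rule bounded_linear.has_derivative[OF L Ck_on_has_derivative[OF Suc.prems that]])
    show "Ck_on k S (\<lambda>x. L (frechet_derivative f (at x) v))" for v
      by (rule Suc.IH) (use Suc.prems in simp)
  qed
qed

lemma Ck_on_add:
  assumes "open S" "Ck_on k S f" "Ck_on k S g"
  shows "Ck_on k S (\<lambda>x. f x + g x)"
  using assms(2,3)
proof (induction k arbitrary: f g)
  case 0
  then show ?case by (auto intro: continuous_on_add)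
next
  case (Suc k)
  show ?case
  proof (rule Ck_on_SucI[OF assms(1)])
    show "((\<lambda>x. f x + g x) has_derivative
        (\<lambda>v. frechet_derivative f (at x) v + frechet_derivative g (at x) v)) (at x)"
      if "x \<in> S" for x
      using that Suc.prems by (intro has_derivative_add Ck_on_has_derivative)
    show "Ck_on k S (\<lambda>x. frechet_derivative f (at x) v + frechet_derivative g (at x) v)" for v
      by (rule Suc.IH) (use Suc.prems in simp_all)
  qed
qed

lemma Ck_on_bilinear:
  assumes B: "bounded_bilinear B" and "open S" "Ck_on k S f" "Ck_on k S g"
  shows "Ck_on k S (\<lambda>x. B (f x) (g x))"
  using assms(3,4)
proof (induction k arbitrary: f g)
  case 0
  then show ?case by (auto intro: bounded_bilinear.continuous_on[OF B])
next
  case (Suc k)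
  show ?case
  proof (rule Ck_on_SucI[OF assms(2)])
    show "((\<lambda>x. B (f x) (g x)) has_derivative
        (\<lambda>v. B (f x) (frechet_derivative g (at x) v) + B (frechet_derivative f (at x) v) (g x))) (at x)"
      if "x \<in> S" for x
      using that Suc.prems by (intro bounded_bilinear.FDERIV[OF B] Ck_on_has_derivative)
    show "Ck_on k S (\<lambda>x. B (f x) (frechet_derivative g (at x) v)
        + B (frechet_derivative f (at x) v) (g x))" for v
      using Suc.prems Ck_on_Suc_imp[of k S f] Ck_on_Suc_imp[of k S g]
      by (intro Ck_on_add[OF assms(2)] Suc.IH) auto
  qed
qed

lemma Ck_on_sum:
  assumes "open S" "\<And>i. i \<in> I \<Longrightarrow> Ck_on k S (f i)"
  shows "Ck_on k S (\<lambda>x. \<Sum>i\<in>I. f i x)"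
  using assms(2)
  by (induction I rule: infinite_finite_induct) (auto intro: Ck_on_add[OF assms(1)] Ck_on_const)

text \<open>The chain rule evaluates the derivative of \<open>f\<close> at a varying vector, while
  the induction hypothesis covers it only for a fixed direction. Expanding the vector in
  \<open>Basis\<close> turns the derivative into a finite sum of products with fixed directions;
  hence the Euclidean space in the middle.\<close>

lemma Ck_on_compose:
  fixes f :: "'b::euclidean_space \<Rightarrow> 'c::real_normed_vector"
  assumes "open S" "open T" "g ` S \<subseteq> T" "Ck_on k T f" "Ck_on k S g"
  shows "Ck_on k S (\<lambda>x. f (g x))"
  using assms(4,5)
proof (induction k arbitrary: f)
  case 0
  then show ?case
    using assms(3) by (auto intro: continuous_on_compose2)
next
  case (Suc k)
  let ?D = "\<lambda>x v. \<Sum>b\<in>Basis. (frechet_derivative g (at x) v \<bullet> b) *\<^sub>R frechet_derivative f (at (g x)) b"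
  show ?case
  proof (rule Ck_on_SucI[OF assms(1)])
    fix x assume x: "x \<in> S"
    let ?L = "frechet_derivative f (at (g x))"
    have L: "(f has_derivative ?L) (at (g x))"
      by (rule Ck_on_has_derivative[OF Suc.prems(1)]) (use x assms(3) in blast)
    have "((\<lambda>x. f (g x)) has_derivative (\<lambda>v. ?L (frechet_derivative g (at x) v))) (at x)"
      by (rule has_derivative_compose[OF Ck_on_has_derivative[OF Suc.prems(2) x] L])
    moreover have "(\<lambda>v. ?L (frechet_derivative g (at x) v)) = ?D x"
    proof
      fix v
      let ?w = "frechet_derivative g (at x) v"
      interpret linear ?L
        by (rule has_derivative_linear[OF L])
      have "?L ?w = ?L (\<Sum>b\<in>Basis. (?w \<bullet> b) *\<^sub>R b)"
        by (simp only: euclidean_representation)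
      also have "\<dots> = ?D x v"
        by (simp only: sum scale)
      finally show "?L ?w = ?D x v" .
    qed
    ultimately show "((\<lambda>x. f (g x)) has_derivative ?D x) (at x)"
      by (simp only:)
  next
    fix v
    have g: "Ck_on k S g"
      by (rule Ck_on_Suc_imp[OF Suc.prems(2)])
    show "Ck_on k S (\<lambda>x. ?D x v)"
    proof (intro Ck_on_sum assms(1) Ck_on_bilinear[OF bounded_bilinear_scaleR])
      fix b :: 'b
      show "Ck_on k S (\<lambda>x. frechet_derivative g (at x) v \<bullet> b)"
        using Suc.prems(2) by (intro Ck_on_bounded_linear[OF bounded_linear_inner_left] assms(1)) auto
      show "Ck_on k S (\<lambda>x. frechet_derivative f (at (g x)) b)"
        using Suc.prems(1) g by (intro Suc.IH) auto
    qed
  qed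
qed

lemma Ck_on_inverse:
  fixes f :: "'a::real_normed_vector \<Rightarrow> real"
  assumes "open S" "\<And>x. x \<in> S \<Longrightarrow> f x \<noteq> 0" "Ck_on k S f"
  shows "Ck_on k S (\<lambda>x. inverse (f x))"
  using assms(3)
proof (induction k)
  case 0
  then show ?case
    using assms(2) by (auto intro: continuous_on_inverse)
next
  case (Suc k)
  have i: "Ck_on k S (\<lambda>x. inverse (f x))"
    by (rule Suc.IH[OF Ck_on_Suc_imp[OF Suc.prems]])
  \<comment> \<open>The sign is a factor \<open>- 1\<close>, so that the rule for bilinear maps
    covers the whole expression. The factors \<open>inverse (f x)\<close> are needed at order
    \<open>k\<close> only, which is the induction hypothesis.\<close>
  let ?D = "\<lambda>x v. - 1 * (inverse (f x) * frechet_derivative f (at x) v * inverse (f x))"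
  show ?case
  proof (rule Ck_on_SucI[OF assms(1)])
    fix x assume x: "x \<in> S"
    show "((\<lambda>x. inverse (f x)) has_derivative ?D x) (at x)"
      using Deriv.has_derivative_inverse[OF assms(2)[OF x] Ck_on_has_derivative[OF Suc.prems x]] by simp
  next
    fix v
    show "Ck_on k S (\<lambda>x. ?D x v)"
      using Suc.prems i
      by (intro Ck_on_bilinear[OF bounded_bilinear_mult] assms(1) Ck_on_const) auto
  qed
qed

section \<open>Closure properties of smooth maps\<close>

lemma smooth_on_subset: "smooth_on S f \<Longrightarrow> T \<subseteq> S \<Longrightarrow> smooth_on T f"
  by (auto simp: smooth_on_def intro: Ck_on_subset)

lemma smooth_on_cong:
  "smooth_on S f \<Longrightarrow> open S \<Longrightarrow> (\<And>x. x \<in> S \<Longrightarrow> f x = g x) \<Longrightarrow> smooth_on S g"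
  unfolding smooth_on_def using Ck_on_cong by blast

lemma smooth_on_locally:
  assumes "\<And>x. x \<in> S \<Longrightarrow> \<exists>T. open T \<and> x \<in> T \<and> smooth_on T f"
  shows "smooth_on S f"
  using assms unfolding smooth_on_def by (meson Ck_on_locally)

lemma smooth_on_has_derivative:
  "smooth_on S f \<Longrightarrow> x \<in> S \<Longrightarrow> (f has_derivative frechet_derivative f (at x)) (at x)"
  unfolding smooth_on_def using Ck_on_has_derivative by blast

lemma smooth_on_imp_continuous_on: "smooth_on S f \<Longrightarrow> continuous_on S f"
  unfolding smooth_on_def using Ck_on.simps(1) by blast

lemma smooth_on_derivative: "smooth_on S f \<Longrightarrow> smooth_on S (\<lambda>x. frechet_derivative f (at x) v)"
  unfolding smooth_on_def using Ck_on.simps(2) by blast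

lemma smooth_on_const: "smooth_on S (\<lambda>x. c)"
  by (simp add: smooth_on_def Ck_on_const)

lemma smooth_on_id: "open S \<Longrightarrow> smooth_on S (\<lambda>x. x)"
  unfolding smooth_on_def
proof
  fix k assume "open S"
  then show "Ck_on k S (\<lambda>x. x)"
    by (cases k) (auto intro!: Ck_on_const Ck_on_SucI[where f'="\<lambda>x v. v"])
qed

lemma smooth_on_bounded_linear:
  "bounded_linear L \<Longrightarrow> open S \<Longrightarrow> smooth_on S f \<Longrightarrow> smooth_on S (\<lambda>x. L (f x))"
  by (auto simp: smooth_on_def intro: Ck_on_bounded_linear)

lemma smooth_on_bilinear:
  "bounded_bilinear B \<Longrightarrow> open S \<Longrightarrow> smooth_on S f \<Longrightarrow> smooth_on S g
    \<Longrightarrow> smooth_on S (\<lambda>x. B (f x) (g x))"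
  by (auto simp: smooth_on_def intro: Ck_on_bilinear)

lemmas smooth_on_inner = smooth_on_bilinear[OF bounded_bilinear_inner]
lemmas smooth_on_mult = smooth_on_bilinear[OF bounded_bilinear_mult]
lemmas smooth_on_scaleR = smooth_on_bilinear[OF bounded_bilinear_scaleR]

lemma smooth_on_add:
  "open S \<Longrightarrow> smooth_on S f \<Longrightarrow> smooth_on S g \<Longrightarrow> smooth_on S (\<lambda>x. f x + g x)"
  by (auto simp: smooth_on_def intro: Ck_on_add)

lemma smooth_on_sum:
  "open S \<Longrightarrow> (\<And>i. i \<in> I \<Longrightarrow> smooth_on S (f i)) \<Longrightarrow> smooth_on S (\<lambda>x. \<Sum>i\<in>I. f i x)"
  by (auto simp: smooth_on_def intro: Ck_on_sum)

lemma smooth_on_prod: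
  fixes f :: "'i \<Rightarrow> 'a::real_normed_vector \<Rightarrow> 'b::{real_normed_algebra,comm_ring_1}"
  assumes "open S" "\<And>i. i \<in> I \<Longrightarrow> smooth_on S (f i)"
  shows "smooth_on S (\<lambda>x. \<Prod>i\<in>I. f i x)"
  using assms(2)
  by (induction I rule: infinite_finite_induct)
    (auto intro: smooth_on_mult[OF assms(1)] smooth_on_const)

lemma smooth_on_compose:
  fixes f :: "'b::euclidean_space \<Rightarrow> 'c::real_normed_vector"
  shows "open S \<Longrightarrow> open T \<Longrightarrow> g ` S \<subseteq> T \<Longrightarrow> smooth_on T f \<Longrightarrow> smooth_on S g
    \<Longrightarrow> smooth_on S (\<lambda>x. f (g x))"
  unfolding smooth_on_def using Ck_on_compose by blast

lemma smooth_on_divide: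
  fixes f g :: "'a::real_normed_vector \<Rightarrow> real"
  assumes "open S" "\<And>x. x \<in> S \<Longrightarrow> g x \<noteq> 0" "smooth_on S f" "smooth_on S g"
  shows "smooth_on S (\<lambda>x. f x / g x)"
proof -
  have "smooth_on S (\<lambda>x. inverse (g x))"
    using assms unfolding smooth_on_def by (auto intro: Ck_on_inverse)
  then show ?thesis
    using assms by (auto simp: divide_inverse intro: smooth_on_mult)
qed

lemma smooth_on_vec:
  fixes f :: "'i::finite \<Rightarrow> 'a::real_normed_vector \<Rightarrow> 'b::real_normed_vector"
  assumes "open S" "\<And>i. smooth_on S (f i)"
  shows "smooth_on S (\<lambda>x. \<chi> i. f i x)"
proof -
  have L: "bounded_linear (\<lambda>c::'b. \<chi> j. if j = i then c else 0)" for i :: 'i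
    by (rule bounded_linear_intro[where K=1])
      (auto simp: vec_eq_iff norm_vec_def L2_set_def if_distrib[of norm] if_distrib[of "\<lambda>x. x ^ 2"] cong: if_cong)
  have "(\<lambda>x. \<chi> i. f i x) = (\<lambda>x. \<Sum>i\<in>UNIV. (\<chi> j. if j = i then f i x else 0))"
    by (auto simp: fun_eq_iff vec_eq_iff)
  then show ?thesis
    using assms by (auto intro!: smooth_on_sum smooth_on_bounded_linear[OF L])
qed

lemma smooth_on_nth: "open S \<Longrightarrow> smooth_on S f \<Longrightarrow> smooth_on S (\<lambda>x. f x $ i)"
  by (rule smooth_on_bounded_linear[OF bounded_linear_vec_nth])

lemma smooth_on_Pair:
  assumes "open S" "smooth_on S f" "smooth_on S g"
  shows "smooth_on S (\<lambda>x. (f x, g x))"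
proof -
  have "smooth_on S (\<lambda>x. (f x, 0) + (0, g x))"
    using assms
    by (intro smooth_on_add smooth_on_bounded_linear[where L="\<lambda>a. (a, 0)"]
        smooth_on_bounded_linear[where L="\<lambda>a. (0, a)"] bounded_linear_Pair
        bounded_linear_ident bounded_linear_zero)
  then show ?thesis by simp
qed

lemma smooth_on_det:
  fixes M :: "'a::real_normed_vector \<Rightarrow> real^'n^'n"
  assumes "open S" "\<And>i. smooth_on S (\<lambda>x. M x $ i)"
  shows "smooth_on S (\<lambda>x. det (M x))"
  unfolding det_def
proof (intro smooth_on_sum smooth_on_mult smooth_on_const smooth_on_prod assms(1))
  fix p i
  show "smooth_on S (\<lambda>x. M x $ i $ p i)"
    by (rule smooth_on_nth[OF assms])
qed

section \<open>A smooth bump function\<close>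

text \<open>The family \<open>flat p\<close> is closed under differentiation, whence its smoothness.\<close>

definition flat :: "real poly \<Rightarrow> real \<Rightarrow> real" where
  "flat p t = (if t > 0 then poly p (inverse t) * exp (- inverse t) else 0)"

lemma poly_exp_neg_tendsto: "((\<lambda>s. poly p s * exp (- s)) \<longlongrightarrow> (0::real)) at_top"
proof -
  have eq: "(\<lambda>s. poly p s * exp (- s)) = (\<lambda>s. \<Sum>i\<le>degree p. coeff p i * (s ^ i / exp s))"
    by (simp add: poly_altdef sum_distrib_right exp_minus divide_inverse mult.assoc)
  have "((\<lambda>s. \<Sum>i\<le>degree p. coeff p i * (s ^ i / exp s)) \<longlongrightarrow> (\<Sum>i\<le>degree p. coeff p i * 0)) at_top"
    by (intro tendsto_sum tendsto_mult tendsto_const tendsto_power_div_exp_0)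
  then show ?thesis
    by (simp add: eq)
qed

text \<open>With \<open>s = inverse t\<close>, differentiating \<open>poly p s * exp (- s)\<close>
  in \<open>s\<close> replaces \<open>p\<close> by \<open>pderiv p - p\<close>, and the inner
  derivative is \<open>- s ^ 2\<close>. This accounts for the order of the difference and for the
  factor \<open>[:0, 0, 1:]\<close>.\<close>

lemma flat_has_derivative:
  "(flat p has_field_derivative flat ((p - pderiv p) * [:0, 0, 1:]) t) (at t)"
proof -
  let ?q = "(p - pderiv p) * [:0, 0, 1:]"
  consider "t > 0" | "t < 0" | "t = 0" by linarith
  then show ?thesis
  proof cases
    case 1
    have "((\<lambda>t. poly p (inverse t) * exp (- inverse t)) has_field_derivative flat ?q t) (at t)"
      using 1 by (auto intro!: derivative_eq_intros
          simp: flat_def field_simps power2_eq_square)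
    then show ?thesis
      by (rule has_field_derivative_transform_within_open[where S="{0<..}"]) (use 1 in \<open>auto simp: flat_def\<close>)
  next
    case 2
    have "((\<lambda>t. 0) has_field_derivative flat ?q t) (at t)"
      using 2 by (auto simp: flat_def)
    then show ?thesis
      by (rule has_field_derivative_transform_within_open[where S="{..<0}"]) (use 2 in \<open>auto simp: flat_def\<close>)
  next
    case 3
    \<comment> \<open>The factor \<open>[:0, 1:]\<close> is the division by \<open>t\<close> in the
      difference quotient at zero: it is one more power of \<open>inverse t\<close>, and the
      exponential still wins.\<close>
    have "((\<lambda>t. poly (p * [:0, 1:]) (inverse t) * exp (- inverse t)) \<longlongrightarrow> 0) (at_right 0)"
      by (rule filterlim_compose[OF poly_exp_neg_tendsto filterlim_inverse_at_top_right])
    then have "((\<lambda>t. flat p t / t) \<longlongrightarrow> 0) (at_right 0)"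
      by (rule Lim_transform_eventually)
        (auto simp: eventually_at_right_less flat_def divide_inverse intro!: eventually_at_rightI[where b=1])
    moreover have "((\<lambda>t. flat p t / t) \<longlongrightarrow> 0) (at_left 0)"
      by (rule Lim_transform_eventually[OF tendsto_const])
        (auto simp: flat_def intro!: eventually_at_leftI[where a="-1"])
    ultimately have "((\<lambda>t. flat p t / t) \<longlongrightarrow> 0) (at 0)"
      by (simp add: filterlim_split_at)
    then show ?thesis
      using 3 by (simp add: has_field_derivative_iff flat_def)
  qed
qed

lemma smooth_on_flat: "smooth_on UNIV (flat p)"
proof -
  have "Ck_on k UNIV (flat p)" for k
  proof (induction k arbitrary: p)
    case 0
    show ?case
      using flat_has_derivative[THEN DERIV_isCont] by (auto intro: continuous_at_imp_continuous_on)
  next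
    case (Suc k)
    show ?case
    proof (rule Ck_on_SucI)
      show "(flat p has_derivative (*) (flat ((p - pderiv p) * [:0, 0, 1:]) x)) (at x)" for x
        using flat_has_derivative by (simp add: has_field_derivative_def)
      show "Ck_on k UNIV (\<lambda>x. flat ((p - pderiv p) * [:0, 0, 1:]) x * v)" for v
        by (intro Ck_on_bilinear[OF bounded_bilinear_mult] Ck_on_const Suc) auto
    qed auto
  qed
  then show ?thesis
    by (simp add: smooth_on_def)
qed

text \<open>\<open>flat 1\<close> is \<open>exp (- inverse t)\<close> for positive \<open>t\<close>
  and zero elsewhere. It is applied to the difference of the squared radius and the squared
  distance, which is positive exactly inside the ball. Writing the squared distance as an inner
  product keeps the argument smooth at the center.\<close>

lemma exists_smooth_bump:
  fixes a :: "'a::real_inner"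
  assumes "r > 0"
  obtains \<psi> :: "'a \<Rightarrow> real" where "smooth_on UNIV \<psi>" "\<psi> a \<noteq> 0" "\<And>y. y \<notin> ball a r \<Longrightarrow> \<psi> y = 0"
proof -
  define \<psi> where "\<psi> y = flat 1 (r\<^sup>2 + (-1) * ((y + - a) \<bullet> (y + - a)))" for y
  have "smooth_on UNIV \<psi>"
    unfolding \<psi>_def
    by (intro smooth_on_compose[OF _ _ _ smooth_on_flat] smooth_on_add smooth_on_mult smooth_on_inner
        smooth_on_const smooth_on_id) simp_all
  moreover have "\<psi> a \<noteq> 0"
    using assms by (simp add: \<psi>_def flat_def)
  moreover have "\<psi> y = 0" if "y \<notin> ball a r" for y
  proof -
    have "r \<le> norm (y + - a)"
      using that by (simp add: dist_norm norm_minus_commute)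
    then have "r\<^sup>2 \<le> (y + - a) \<bullet> (y + - a)"
      using assms by (metis less_imp_le power_mono power2_norm_eq_inner)
    then show ?thesis
      by (simp add: \<psi>_def flat_def)
  qed
  ultimately show ?thesis
    using that by blast
qed

section \<open>Charts of a smooth manifold\<close>

lemma param_coord: "is_chart X \<kappa> \<Longrightarrow> x \<in> dom_of \<kappa> \<Longrightarrow> param \<kappa> (coord \<kappa> x) = x"
proof -
  assume c: "is_chart X \<kappa>" and x: "x \<in> dom_of \<kappa>"
  have "inj_on (coord \<kappa>) (topspace (subtopology X (dom_of \<kappa>)))"
    using c homeomorphic_imp_injective_map unfolding is_chart_def by blast
  moreover have "topspace (subtopology X (dom_of \<kappa>)) = dom_of \<kappa>"
    using c openin_subset by (auto simp: is_chart_def topspace_subtopology)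
  ultimately show ?thesis
    using x by (simp add: param_def)
qed

lemma coord_param: "y \<in> coord \<kappa> ` dom_of \<kappa> \<Longrightarrow> coord \<kappa> (param \<kappa> y) = y"
  by (simp add: param_def f_inv_into_f)

lemma param_in_dom: "y \<in> coord \<kappa> ` dom_of \<kappa> \<Longrightarrow> param \<kappa> y \<in> dom_of \<kappa>"
  by (simp add: param_def inv_into_into)

lemma open_coord_image:
  assumes "is_chart X \<kappa>" "openin X U" "U \<subseteq> dom_of \<kappa>"
  shows "open (coord \<kappa> ` U)"
proof -
  have "open_map (subtopology X (dom_of \<kappa>)) (top_of_set (coord \<kappa> ` dom_of \<kappa>)) (coord \<kappa>)"
    using assms(1) homeomorphic_imp_open_map by (auto simp: is_chart_def)
  moreover have "openin (subtopology X (dom_of \<kappa>)) U"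
    using assms by (auto simp: openin_subtopology)
  ultimately have "openin (top_of_set (coord \<kappa> ` dom_of \<kappa>)) (coord \<kappa> ` U)"
    by (simp add: open_map_def)
  then show ?thesis
    using assms(1) openin_open_eq by (auto simp: is_chart_def)
qed

text \<open>Transports open and compact sets from coordinates back to \<open>X\<close>. The inverse
  supplied by the homeomorphism agrees with \<open>param\<close> on the image of the chart, which is
  all that matters here.\<close>

lemma homeomorphic_map_param:
  assumes "is_chart X \<kappa>"
  shows "homeomorphic_map (top_of_set (coord \<kappa> ` dom_of \<kappa>)) (subtopology X (dom_of \<kappa>)) (param \<kappa>)"
proof -
  obtain g where g: "homeomorphic_maps (subtopology X (dom_of \<kappa>)) (top_of_set (coord \<kappa> ` dom_of \<kappa>)) (coord \<kappa>) g"
    using assms by (auto simp: is_chart_def homeomorphic_map_maps)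
  have "topspace (subtopology X (dom_of \<kappa>)) = dom_of \<kappa>"
    using assms openin_subset by (auto simp: is_chart_def topspace_subtopology)
  then have "g y = param \<kappa> y" if "y \<in> coord \<kappa> ` dom_of \<kappa>" for y
    using g that param_coord[OF assms] by (auto simp: homeomorphic_maps_def)
  moreover have "homeomorphic_map (top_of_set (coord \<kappa> ` dom_of \<kappa>)) (subtopology X (dom_of \<kappa>)) g"
    using g homeomorphic_maps_sym homeomorphic_map_maps by blast
  ultimately show ?thesis
    using homeomorphic_map_eq by fastforce
qed

lemma openin_param_image:
  assumes "is_chart X \<kappa>" "open V" "V \<subseteq> coord \<kappa> ` dom_of \<kappa>"
  shows "openin X (param \<kappa> ` V)"
proof -
  have "open_map (top_of_set (coord \<kappa> ` dom_of \<kappa>)) (subtopology X (dom_of \<kappa>)) (param \<kappa>)"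
    using homeomorphic_imp_open_map[OF homeomorphic_map_param[OF assms(1)]] .
  then have "openin (subtopology X (dom_of \<kappa>)) (param \<kappa> ` V)"
    using assms(2,3) by (auto simp: open_map_def openin_open)
  then show ?thesis
    using assms(1) openin_trans_full by (auto simp: is_chart_def)
qed

lemma compactin_param_image:
  assumes "is_chart X \<kappa>" "compact K" "K \<subseteq> coord \<kappa> ` dom_of \<kappa>"
  shows "compactin X (param \<kappa> ` K)"
proof -
  have "continuous_map (top_of_set (coord \<kappa> ` dom_of \<kappa>)) (subtopology X (dom_of \<kappa>)) (param \<kappa>)"
    using homeomorphic_imp_continuous_map[OF homeomorphic_map_param[OF assms(1)]] .
  moreover have "compactin (top_of_set (coord \<kappa> ` dom_of \<kappa>)) K"
    using assms(2,3) by (simp add: compactin_subtopology)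
  ultimately have "compactin (subtopology X (dom_of \<kappa>)) (param \<kappa> ` K)"
    by (rule image_compactin[rotated])
  then show ?thesis
    by (simp add: compactin_subtopology)
qed

context
  fixes X :: "'a topology" and A :: "('a, 'e::euclidean_space) chart set"
  assumes mfd: "smooth_manifold X A"
begin

lemma atlas_chart: "\<kappa> \<in> A \<Longrightarrow> is_chart X \<kappa>"
  using mfd by (simp add: smooth_manifold_def)

lemma atlas_dom: "\<kappa> \<in> A \<Longrightarrow> openin X (dom_of \<kappa>)"
  using atlas_chart by (simp add: is_chart_def)

lemma atlas_dom_subset: "\<kappa> \<in> A \<Longrightarrow> dom_of \<kappa> \<subseteq> topspace X"
  by (simp add: atlas_dom openin_subset)

lemma atlas_open: "\<kappa> \<in> A \<Longrightarrow> open (coord \<kappa> ` dom_of \<kappa>)"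
  using atlas_chart by (simp add: is_chart_def)

lemma atlas_cover: "x \<in> topspace X \<Longrightarrow> \<exists>\<kappa>\<in>A. x \<in> dom_of \<kappa>"
  using mfd by (auto simp: smooth_manifold_def)

lemma atlas_param_coord: "\<kappa> \<in> A \<Longrightarrow> x \<in> dom_of \<kappa> \<Longrightarrow> param \<kappa> (coord \<kappa> x) = x"
  by (rule param_coord[OF atlas_chart])

lemma open_overlap:
  assumes "\<kappa> \<in> A" "openin X U"
  shows "open (coord \<kappa> ` (dom_of \<kappa> \<inter> U))"
  by (rule open_coord_image[OF atlas_chart[OF assms(1)] openin_Int[OF atlas_dom[OF assms(1)] assms(2)]]) simp

lemma transition_smooth:
  "\<kappa> \<in> A \<Longrightarrow> \<kappa>' \<in> A \<Longrightarrow>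
    smooth_on (coord \<kappa> ` (dom_of \<kappa> \<inter> dom_of \<kappa>')) (\<lambda>y. coord \<kappa>' (param \<kappa> y))"
  using mfd by (auto simp: smooth_manifold_def comp_def)

lemma smooth_on_change_chart:
  assumes \<kappa>: "\<kappa> \<in> A" "\<kappa>' \<in> A" and U: "openin X U" "U \<subseteq> dom_of \<kappa>'"
    and f: "smooth_on (coord \<kappa>' ` U) (\<lambda>y. f (param \<kappa>' y))"
  shows "smooth_on (coord \<kappa> ` (dom_of \<kappa> \<inter> U)) (\<lambda>y. f (param \<kappa> y))"
proof -
  let ?S = "coord \<kappa> ` (dom_of \<kappa> \<inter> U)"
  have S: "open ?S"
    by (rule open_overlap[OF \<kappa>(1) U(1)])
  have "smooth_on ?S (\<lambda>y. f (param \<kappa>' (coord \<kappa>' (param \<kappa> y))))"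
  proof (rule smooth_on_compose[OF S open_coord_image[OF atlas_chart[OF \<kappa>(2)] U] _ f])
    show "(\<lambda>y. coord \<kappa>' (param \<kappa> y)) ` ?S \<subseteq> coord \<kappa>' ` U"
      using atlas_param_coord[OF \<kappa>(1)] by auto
    show "smooth_on ?S (\<lambda>y. coord \<kappa>' (param \<kappa> y))"
      by (rule smooth_on_subset[OF transition_smooth[OF \<kappa>]]) (use U in auto)
  qed
  then show ?thesis
    by (rule smooth_on_cong[OF _ S])
      (use U(2) atlas_param_coord[OF \<kappa>(1)] atlas_param_coord[OF \<kappa>(2)] in auto)
qed

text \<open>The definition provides one chart and one neighbourhood per point. Smooth transition
  maps carry this over to any other chart of the atlas, and since smoothness is local, the pieces
  cover the whole image of that chart.\<close>

lemma smooth_map_std_iff: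
  fixes f :: "'a \<Rightarrow> 'f::euclidean_space"
  shows "smooth_map X A std_atlas f
    \<longleftrightarrow> (\<forall>\<kappa>\<in>A. smooth_on (coord \<kappa> ` dom_of \<kappa>) (\<lambda>y. f (param \<kappa> y)))"
proof
  assume f: "smooth_map X A std_atlas f"
  show "\<forall>\<kappa>\<in>A. smooth_on (coord \<kappa> ` dom_of \<kappa>) (\<lambda>y. f (param \<kappa> y))"
  proof
    fix \<kappa> assume \<kappa>: "\<kappa> \<in> A"
    show "smooth_on (coord \<kappa> ` dom_of \<kappa>) (\<lambda>y. f (param \<kappa> y))"
    proof (rule smooth_on_locally)
      fix y assume y: "y \<in> coord \<kappa> ` dom_of \<kappa>"
      then obtain x where x: "x \<in> dom_of \<kappa>" "y = coord \<kappa> x"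
        by blast
      then have "x \<in> topspace X"
        using atlas_dom_subset[OF \<kappa>] by blast
      then obtain \<kappa>' U where U: "\<kappa>' \<in> A" "openin X U" "x \<in> U" "U \<subseteq> dom_of \<kappa>'"
        and "smooth_on (coord \<kappa>' ` U) (\<lambda>y. f (param \<kappa>' y))"
        using f by (fastforce simp: smooth_map_def std_atlas_def comp_def)
      then have "smooth_on (coord \<kappa> ` (dom_of \<kappa> \<inter> U)) (\<lambda>y. f (param \<kappa> y))"
        using smooth_on_change_chart[OF \<kappa>] by blast
      then show "\<exists>T. open T \<and> y \<in> T \<and> smooth_on T (\<lambda>y. f (param \<kappa> y))"
        using open_overlap[OF \<kappa> U(2)] x U(3) by blast
    qed
  qed
next
  assume f: "\<forall>\<kappa>\<in>A. smooth_on (coord \<kappa> ` dom_of \<kappa>) (\<lambda>y. f (param \<kappa> y))"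
  show "smooth_map X A std_atlas f"
    unfolding smooth_map_def
  proof
    fix x assume "x \<in> topspace X"
    then obtain \<kappa> where "\<kappa> \<in> A" "x \<in> dom_of \<kappa>"
      using atlas_cover by blast
    then show "\<exists>\<kappa>\<in>A. \<exists>\<beta>\<in>std_atlas. \<exists>U. openin X U \<and> x \<in> U \<and> U \<subseteq> dom_of \<kappa> \<and> f ` U \<subseteq> dom_of \<beta>
        \<and> smooth_on (coord \<kappa> ` U) (coord \<beta> \<circ> f \<circ> param \<kappa>)"
      using f atlas_dom
      by (intro bexI[of _ \<kappa>] bexI[of _ "(UNIV, \<lambda>x. x)"] exI[of _ "dom_of \<kappa>"])
        (auto simp: std_atlas_def comp_def)
  qed
qed

section \<open>Tangent vectors and differentials in coordinates\<close>

lemma transition_has_derivative: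
  assumes "\<kappa> \<in> A" "\<kappa>' \<in> A" "x \<in> dom_of \<kappa>" "x \<in> dom_of \<kappa>'"
  shows "((\<lambda>y. coord \<kappa>' (param \<kappa> y)) has_derivative
    frechet_derivative (\<lambda>y. coord \<kappa>' (param \<kappa> y)) (at (coord \<kappa> x))) (at (coord \<kappa> x))"
  by (rule smooth_on_has_derivative[OF transition_smooth[OF assms(1,2)]]) (use assms in auto)

lemma derivative_change_chart:
  assumes \<kappa>: "\<kappa> \<in> A" "\<kappa>' \<in> A" and x: "x \<in> dom_of \<kappa>" "x \<in> dom_of \<kappa>'"
    and f: "((\<lambda>y. f (param \<kappa>' y)) has_derivative f') (at (coord \<kappa>' x))"
  shows "((\<lambda>y. f (param \<kappa> y)) has_derivative
    (\<lambda>w. f' (frechet_derivative (\<lambda>y. coord \<kappa>' (param \<kappa> y)) (at (coord \<kappa> x)) w))) (at (coord \<kappa> x))"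
proof -
  have "((\<lambda>y. f (param \<kappa>' (coord \<kappa>' (param \<kappa> y)))) has_derivative
    (\<lambda>w. f' (frechet_derivative (\<lambda>y. coord \<kappa>' (param \<kappa> y)) (at (coord \<kappa> x)) w))) (at (coord \<kappa> x))"
    by (rule has_derivative_compose[OF transition_has_derivative[OF \<kappa> x]])
      (simp only: atlas_param_coord[OF \<kappa>(1) x(1)] f)
  then show ?thesis
    by (rule has_derivative_transform_within_open[OF _ open_overlap[OF \<kappa>(1) atlas_dom[OF \<kappa>(2)]]])
      (use x atlas_param_coord[OF \<kappa>(1)] atlas_param_coord[OF \<kappa>(2)] in auto)
qed

text \<open>The chart picked by \<open>SOME\<close> is irrelevant: the chain rule for the change of
  charts and the transformation law of \<open>v\<close> bring in the same transition
  derivative.\<close>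

lemma differential_chart:
  assumes v: "v \<in> tangent_space A x" and \<kappa>: "\<kappa> \<in> A" "x \<in> dom_of \<kappa>"
    and f: "\<And>\<kappa>. \<kappa> \<in> A \<Longrightarrow> smooth_on (coord \<kappa> ` dom_of \<kappa>) (\<lambda>y. f (param \<kappa> y))"
  shows "differential A x f v = frechet_derivative (\<lambda>y. f (param \<kappa> y)) (at (coord \<kappa> x)) (v \<kappa>)"
proof -
  define \<kappa>' where "\<kappa>' = (SOME \<kappa>. \<kappa> \<in> charts_at A x)"
  have "\<kappa> \<in> charts_at A x"
    using \<kappa> by (simp add: charts_at_def)
  then have "\<kappa>' \<in> charts_at A x"
    unfolding \<kappa>'_def by (rule someI)
  then have \<kappa>': "\<kappa>' \<in> A" "x \<in> dom_of \<kappa>'"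
    by (auto simp: charts_at_def)
  have "((\<lambda>y. f (param \<kappa>' y)) has_derivative
      frechet_derivative (\<lambda>y. f (param \<kappa>' y)) (at (coord \<kappa>' x))) (at (coord \<kappa>' x))"
    by (rule smooth_on_has_derivative[OF f[OF \<kappa>'(1)]]) (use \<kappa>' in auto)
  note D = frechet_derivative_at[OF derivative_change_chart[OF \<kappa>(1) \<kappa>'(1) \<kappa>(2) \<kappa>'(2) this], symmetric]
  have c: "\<kappa> \<in> charts_at A x" "\<kappa>' \<in> charts_at A x"
    using \<kappa> \<kappa>' by (simp_all add: charts_at_def)
  have v: "v \<kappa>' = frechet_derivative (\<lambda>y. coord \<kappa>' (param \<kappa> y)) (at (coord \<kappa> x)) (v \<kappa>)"
    using v[unfolded tangent_space_def, THEN CollectD, THEN conjunct2, rule_format, OF c]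
    unfolding comp_def .
  show ?thesis
    unfolding differential_def Let_def \<kappa>'_def[symmetric] comp_def D v ..
qed

text \<open>Components prescribed in one chart are transported to the others by the transition
  derivatives. Compatibility between two further charts is the chain rule for the composed
  transition.\<close>

lemma tangent_vector_exists:
  assumes \<kappa>: "\<kappa> \<in> A" "x \<in> dom_of \<kappa>"
  obtains v where "v \<in> tangent_space A x" "v \<kappa> = w"
proof -
  let ?D = "\<lambda>\<kappa> \<kappa>'. frechet_derivative (\<lambda>y. coord \<kappa>' (param \<kappa> y)) (at (coord \<kappa> x))"
  define v where "v = restrict (\<lambda>\<kappa>'. ?D \<kappa> \<kappa>' w) (charts_at A x)"
  have "v \<in> tangent_space A x"
    unfolding tangent_space_def
  proof (intro CollectI conjI ballI)
    show "v \<in> extensional (charts_at A x)"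
      by (simp add: v_def)
    fix \<kappa>1 \<kappa>2 assume "\<kappa>1 \<in> charts_at A x" "\<kappa>2 \<in> charts_at A x"
    then have *: "\<kappa>1 \<in> A" "\<kappa>2 \<in> A" "x \<in> dom_of \<kappa>1" "x \<in> dom_of \<kappa>2"
      and c: "\<kappa>1 \<in> charts_at A x" "\<kappa>2 \<in> charts_at A x"
      by (auto simp: charts_at_def)
    have "?D \<kappa> \<kappa>2 = (\<lambda>w. ?D \<kappa>1 \<kappa>2 (?D \<kappa> \<kappa>1 w))"
      by (rule frechet_derivative_at[symmetric])
        (rule derivative_change_chart[OF \<kappa>(1) *(1) \<kappa>(2) *(3) transition_has_derivative[OF *]])
    then have "?D \<kappa> \<kappa>2 w = ?D \<kappa>1 \<kappa>2 (?D \<kappa> \<kappa>1 w)"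
      by (rule fun_cong)
    then show "v \<kappa>2 = frechet_derivative (coord \<kappa>2 \<circ> param \<kappa>1) (at (coord \<kappa>1 x)) (v \<kappa>1)"
      unfolding v_def comp_def restrict_apply'[OF c(1)] restrict_apply'[OF c(2)] .
  qed
  moreover have "v \<kappa> = w"
  proof -
    have "((\<lambda>y. coord \<kappa> (param \<kappa> y)) has_derivative (\<lambda>w. w)) (at (coord \<kappa> x))"
      by (rule has_derivative_transform_within_open[OF has_derivative_ident atlas_open[OF \<kappa>(1)]])
        (use \<kappa> in \<open>simp_all add: coord_param\<close>)
    then have "?D \<kappa> \<kappa> = (\<lambda>w. w)"
      by (rule frechet_derivative_at[symmetric])
    then show ?thesis
      using \<kappa> by (simp add: v_def charts_at_def)
  qed
  ultimately show ?thesis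
    using that by blast
qed

lemma differential_image_chart:
  fixes f :: "'a \<Rightarrow> real^'m"
  assumes \<kappa>: "\<kappa> \<in> A" "x \<in> dom_of \<kappa>"
    and f: "\<And>\<kappa>. \<kappa> \<in> A \<Longrightarrow> smooth_on (coord \<kappa> ` dom_of \<kappa>) (\<lambda>y. f (param \<kappa> y))"
  shows "differential A x f ` tangent_space A x
    = range (frechet_derivative (\<lambda>y. f (param \<kappa> y)) (at (coord \<kappa> x)))"
proof -
  let ?D = "frechet_derivative (\<lambda>y. f (param \<kappa> y)) (at (coord \<kappa> x))"
  have "?D w \<in> differential A x f ` tangent_space A x" for w
  proof -
    obtain v where v: "v \<in> tangent_space A x" "v \<kappa> = w"
      using tangent_vector_exists[OF \<kappa>] .
    then show ?thesis
      using differential_chart[OF v(1) \<kappa> f] by (intro image_eqI[OF _ v(1)]) simp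
  qed
  moreover have "differential A x f v \<in> range ?D" if "v \<in> tangent_space A x" for v
    using differential_chart[OF that \<kappa> f] by simp
  ultimately show ?thesis
    by blast
qed

end

section \<open>Linear algebra and charts of the sphere\<close>

text \<open>The cofactors along row \<open>k\<close>, that is, a generalized cross product of the
  other rows. Being polynomial in these rows, it inherits their smoothness.\<close>

definition cofactor_row :: "('m::finite \<Rightarrow> real^'m) \<Rightarrow> 'm \<Rightarrow> real^'m" where
  "cofactor_row R k = (\<chi> j. det (\<chi> i. if i = k then axis j 1 else R i))"

lemma cofactor_row_inner: "cofactor_row R k \<bullet> w = det (\<chi> i. if i = k then w else R i)"
proof -
  have "det (\<chi> i. if i = k then w else R i)
      = det (\<chi> i. if i = k then \<Sum>j\<in>UNIV. w $ j *s axis j 1 else R i)"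
    by (simp only: basis_expansion)
  also have "\<dots> = (\<Sum>j\<in>UNIV. w $ j * det (\<chi> i. if i = k then axis j 1 else R i))"
    by (simp only: det_linear_row_sum[OF finite] det_row_mul)
  finally show ?thesis
    by (simp add: cofactor_row_def inner_vec_def mult.commute)
qed

text \<open>Among all choices of a point and of rows, each row a constant or a member of \<open>G\<close>, with nonzero
  determinant, take one with as many rows from \<open>G\<close> as possible. Putting a further member of \<open>G\<close> in the
  place of a constant row then annihilates the determinant at every point, so the cofactors of that
  row form the desired map.\<close>

lemma smooth_orthogonal_section:
  fixes G :: "('e::real_normed_vector \<Rightarrow> real^'m) set"
  assumes V: "open V" "V \<noteq> {}" and sm: "\<And>g. g \<in> G \<Longrightarrow> smooth_on V g"
    and deg: "\<And>y. y \<in> V \<Longrightarrow> span ((\<lambda>g. g y) ` G) \<noteq> UNIV"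
  shows "\<exists>h. smooth_on V h \<and> (\<exists>a\<in>V. h a \<noteq> 0) \<and> (\<forall>g\<in>G. \<forall>y\<in>V. h y \<bullet> g y = 0)"
proof -
  define P where "P m \<longleftrightarrow> (\<exists>y\<in>V. \<exists>R K. card K = m \<and> (\<forall>i\<in>K. R i \<in> G) \<and>
    (\<forall>i\<in>-K. \<exists>c. R i = (\<lambda>_. c)) \<and> det (\<chi> i. R i y) \<noteq> 0)" for m
  have "P 0"
  proof -
    have "(\<chi> i. axis i 1) = (mat 1 :: real^'m^'m)"
      by (simp add: mat_def axis_def vec_eq_iff eq_commute)
    moreover obtain y where "y \<in> V" using V by blast
    ultimately show ?thesis
      unfolding P_def
      by (intro bexI[of _ y] exI[of _ "\<lambda>i _. axis i 1"] exI[of _ "{}"]) auto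
  qed
  moreover have bound: "m \<le> CARD('m)" if "P m" for m
    using that card_mono[OF finite subset_UNIV] unfolding P_def by blast
  ultimately have "P (Greatest P)" and max: "\<And>m. P m \<Longrightarrow> m \<le> Greatest P"
    by (blast intro: GreatestI_nat Greatest_le_nat)+
  then obtain a R K where a: "a \<in> V" and K: "card K = Greatest P" "\<And>i. i \<in> K \<Longrightarrow> R i \<in> G"
    and const: "\<And>i. i \<notin> K \<Longrightarrow> \<exists>c. R i = (\<lambda>_. c)" and det: "det (\<chi> i. R i a) \<noteq> 0"
    unfolding P_def by blast
  have "K \<noteq> UNIV"
  proof
    assume "K = UNIV"
    let ?M = "\<chi> i. R i a"
    have "rows ?M \<subseteq> (\<lambda>g. g a) ` G"
      using K(2) \<open>K = UNIV\<close> by (auto simp: rows_def row_def)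
    moreover have "span (rows ?M) = UNIV"
      using det matrix_left_invertible_span_rows[of ?M] invertible_det_nz[of ?M]
      unfolding invertible_def by blast
    ultimately show False
      using deg[OF a] span_mono by blast
  qed
  then obtain k where k: "k \<notin> K" by blast
  define h where "h y = cofactor_row (\<lambda>i. R i y) k" for y
  have R: "smooth_on V (R i)" for i
  proof (cases "i \<in> K")
    case True
    then show ?thesis by (rule sm[OF K(2)])
  next
    case False
    then obtain c where "R i = (\<lambda>_. c)" using const by blast
    then show ?thesis by (simp add: smooth_on_const)
  qed
  have "smooth_on V h"
    unfolding h_def cofactor_row_def
  proof (intro smooth_on_vec smooth_on_det V(1))
    fix i j
    show "smooth_on V (\<lambda>y. (\<chi> i. if i = k then axis j 1 else R i y) $ i)"
      using R[of i] by (cases "i = k") (simp_all add: smooth_on_const)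
  qed
  moreover have "h a \<noteq> 0"
  proof
    assume "h a = 0"
    then have "det (\<chi> i. if i = k then R k a else R i a) = 0"
      unfolding h_def cofactor_row_inner[symmetric] by simp
    moreover have "(\<chi> i. if i = k then R k a else R i a) = (\<chi> i. R i a)"
      by (simp add: vec_eq_iff)
    ultimately show False
      using det by simp
  qed
  \<comment> \<open>The point \<open>y\<close> need not be the point \<open>a\<close> at which the
    maximum was found. This is why \<open>P\<close> also quantifies over the point: a nonzero
    determinant anywhere in \<open>V\<close> with one more row from \<open>G\<close> contradicts
    maximality.\<close>
  moreover have "h y \<bullet> g y = 0" if g: "g \<in> G" and y: "y \<in> V" for g y
  proof (rule ccontr)
    assume "h y \<bullet> g y \<noteq> 0"
    then have "det (\<chi> i. (R(k := g)) i y) \<noteq> 0"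
      unfolding h_def cofactor_row_inner by (simp add: if_distrib[of "\<lambda>f. f y"] fun_upd_def cong: if_cong)
    moreover have "card (insert k K) = Suc (Greatest P)"
      using k K(1) by (simp add: card_insert_if)
    moreover have "\<forall>i\<in>insert k K. (R(k := g)) i \<in> G" "\<forall>i\<in>- insert k K. \<exists>c. (R(k := g)) i = (\<lambda>_. c)"
      using K(2) g const by auto
    ultimately have "P (Suc (Greatest P))"
      unfolding P_def using y by blast
    then show False
      using max by fastforce
  qed
  ultimately show ?thesis
    using a by blast
qed

text \<open>A single additional vector raises the dimension by at most one, so the range has
  dimension at least n; its domain bounds it by n from above.\<close>

lemma span_insert_range_UNIV:
  fixes L :: "real^'n \<Rightarrow> real^'m"
  assumes "linear L" "CARD('m) = CARD('n) + 1" "span (insert p (range L)) = UNIV"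
  shows "dim (range L) = CARD('n)"
proof -
  have "dim (range L) \<le> CARD('n)"
    using dim_image_le[OF assms(1), of UNIV] by simp
  moreover have "dim (insert p (range L)) = CARD('m)"
    using assms(3) by (metis DIM_cart DIM_real dim_UNIV dim_span mult.right_neutral)
  moreover have "dim (insert p (range L)) \<le> dim (range L) + 1"
    by (simp add: dim_insert)
  ultimately show ?thesis
    using assms(2) by linarith
qed

text \<open>The unit vector \<open>p\<close> is orthogonal to the range and so lies outside its
  span; together they fill the space. Thus \<open>u\<close> is orthogonal to everything, in
  particular to itself. It is applied to the derivative of \<open>\<nu>\<close> at a regular point
  and to the derivative of a parametrization of the sphere.\<close>

lemma orthogonal_to_hyperplane_and_normal:
  fixes L :: "real^'n \<Rightarrow> real^'m"
  assumes "CARD('m) = CARD('n) + 1" "dim (range L) = CARD('n)"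
    and p: "p \<bullet> p = 1" "\<And>w. L w \<bullet> p = 0" and u: "u \<bullet> p = 0" "\<And>w. u \<bullet> L w = 0"
  shows "u = 0"
proof -
  have "p \<notin> span (range L)"
  proof
    assume "p \<in> span (range L)"
    moreover have "x \<bullet> p = 0" if "x \<in> span (range L)" for x
      using that by (induction rule: span_induct) (auto simp: subspace_def inner_add_left p)
    ultimately show False
      using p(1) by force
  qed
  then have "dim (insert p (range L)) = DIM(real^'m)"
    using assms(1,2) unfolding dim_insert by simp
  then have "u \<in> span (insert p (range L))"
    unfolding dim_eq_full by simp
  moreover have "u \<bullet> x = 0" if "x \<in> span (insert p (range L))" for x
    using that by (induction rule: span_induct) (auto simp: subspace_def inner_add_right u)
  ultimately show ?thesis
    using inner_eq_zero_iff by blast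
qed

text \<open>Cramer's rule writes \<open>F\<close> as a quotient of determinants in smooth entries,
  and the trivial kernel keeps the denominator away from zero. No regularity of \<open>F\<close> is
  presupposed, so it may come from a pointwise choice.\<close>

lemma smooth_on_linear_solution:
  fixes M :: "'e::real_normed_vector \<Rightarrow> real^'m^'m"
  assumes S: "open S" and M: "\<And>i. smooth_on S (\<lambda>y. M y $ i)" and c: "\<And>i. smooth_on S (\<lambda>y. c y $ i)"
    and sol: "\<And>y. y \<in> S \<Longrightarrow> M y *v F y = c y"
    and inj: "\<And>y u. y \<in> S \<Longrightarrow> M y *v u = 0 \<Longrightarrow> u = 0"
  shows "smooth_on S F"
proof -
  have nz: "det (M y) \<noteq> 0" if "y \<in> S" for y
  proof -
    have "\<exists>B. B ** M y = mat 1"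
      unfolding matrix_left_invertible_ker using inj[OF that] by simp
    then show ?thesis
      by (simp add: invertible_left_inverse[symmetric] invertible_det_nz)
  qed
  have "smooth_on S (\<lambda>y. \<chi> k. det (\<chi> i j. if j = k then c y $ i else M y $ i $ j) / det (M y))"
  proof (intro smooth_on_vec S smooth_on_divide smooth_on_det M)
    fix i k
    have "smooth_on S (\<lambda>y. \<chi> j. if j = k then c y $ i else M y $ i $ j)"
    proof (rule smooth_on_vec[OF S])
      fix j
      show "smooth_on S (\<lambda>y. if j = k then c y $ i else M y $ i $ j)"
        using c[of i] smooth_on_nth[OF S M] by (cases "j = k") simp_all
    qed
    then show "smooth_on S (\<lambda>y. (\<chi> i j. if j = k then c y $ i else M y $ i $ j) $ i)"
      by simp
  qed (rule nz)
  then show ?thesis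
  proof (rule smooth_on_cong[OF _ S])
    fix y assume "y \<in> S"
    then show "(\<chi> k. det (\<chi> i j. if j = k then c y $ i else M y $ i $ j) / det (M y)) = F y"
      using cramer[OF nz, THEN iffD1, OF _ sol] by simp
  qed
qed

lemma inner_derivative:
  assumes S: "open S" "y \<in> S" and eq: "\<And>z. z \<in> S \<Longrightarrow> f z \<bullet> g z = (\<gamma> z :: real)"
    and f: "(f has_derivative f') (at y)" and g: "(g has_derivative g') (at y)"
  shows "frechet_derivative \<gamma> (at y) w = f y \<bullet> g' w + f' w \<bullet> g y"
proof -
  have "(\<gamma> has_derivative (\<lambda>w. f y \<bullet> g' w + f' w \<bullet> g y)) (at y)"
    by (rule has_derivative_transform_within_open[OF has_derivative_inner[OF f g] S]) (rule eq)
  note D = frechet_derivative_at[OF this]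
  show ?thesis
    unfolding D[symmetric] ..
qed

lemma unit_vector_derivative:
  fixes f :: "'a::real_normed_vector \<Rightarrow> 'b::real_inner"
  assumes "open S" "y \<in> S" "\<And>z. z \<in> S \<Longrightarrow> norm (f z) = 1" "(f has_derivative f') (at y)"
  shows "f' w \<bullet> f y = 0"
proof -
  have "f z \<bullet> f z = 1" if "z \<in> S" for z
    using assms(3)[OF that] by (simp add: dot_square_norm)
  note * = inner_derivative[where \<gamma>="\<lambda>_. 1", OF assms(1,2) this assms(4,4), of w]
  have "frechet_derivative (\<lambda>_::'a. 1::real) (at y) w = 0"
    by simp
  with * show ?thesis
    by (simp add: inner_commute)
qed

section \<open>Regular parametrizations of the unit sphere\<close>

lemma sphere_chart:
  fixes \<beta> :: "(real^'m, real^'n) chart"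
  assumes "\<beta> \<in> sphere_atlas"
  shows "is_chart (top_of_set (sphere 0 1)) \<beta>" "dom_of \<beta> \<subseteq> sphere 0 1"
    "open (coord \<beta> ` dom_of \<beta>)" "smooth_on (coord \<beta> ` dom_of \<beta>) (param \<beta>)"
    "\<And>y. y \<in> coord \<beta> ` dom_of \<beta> \<Longrightarrow> inj (frechet_derivative (param \<beta>) (at y))"
proof -
  show c: "is_chart (top_of_set (sphere 0 1)) \<beta>"
    "smooth_on (coord \<beta> ` dom_of \<beta>) (param \<beta>)"
    "\<And>y. y \<in> coord \<beta> ` dom_of \<beta> \<Longrightarrow> inj (frechet_derivative (param \<beta>) (at y))"
    using assms by (auto simp: sphere_atlas_def)
  show "open (coord \<beta> ` dom_of \<beta>)"
    using c(1) by (simp add: is_chart_def)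
  have "openin (top_of_set (sphere 0 1)) (dom_of \<beta>)"
    using c(1) by (simp add: is_chart_def)
  then show "dom_of \<beta> \<subseteq> sphere 0 1"
    by (rule openin_imp_subset)
qed

lemma sphere_chart_tangent:
  fixes \<beta> :: "(real^'m, real^'n) chart"
  assumes "\<beta> \<in> sphere_atlas" "p \<in> dom_of \<beta>"
  shows "frechet_derivative (param \<beta>) (at (coord \<beta> p)) w \<bullet> p = 0"
proof -
  have y: "coord \<beta> p \<in> coord \<beta> ` dom_of \<beta>"
    using assms(2) by simp
  have "norm (param \<beta> z) = 1" if "z \<in> coord \<beta> ` dom_of \<beta>" for z
    using sphere_chart(2)[OF assms(1)] param_in_dom[OF that] by auto
  from unit_vector_derivative[OF sphere_chart(3)[OF assms(1)] y this
      smooth_on_has_derivative[OF sphere_chart(4)[OF assms(1)] y]]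
  show ?thesis
    unfolding param_coord[OF sphere_chart(1)[OF assms(1)] assms(2)] .
qed

lemma sphere_chart_dim:
  fixes \<beta> :: "(real^'m, real^'n) chart"
  assumes "\<beta> \<in> sphere_atlas" "y \<in> coord \<beta> ` dom_of \<beta>"
  shows "dim (range (frechet_derivative (param \<beta>) (at y))) = CARD('n)"
proof -
  have "linear (frechet_derivative (param \<beta>) (at y))"
    by (rule has_derivative_linear[OF smooth_on_has_derivative[OF sphere_chart(4)[OF assms(1)] assms(2)]])
  then show ?thesis
    using sphere_chart(5)[OF assms] by (simp add: dim_image_eq)
qed

section \<open>Smooth maps and their derivatives in charts\<close>

text \<open>For Euclidean targets on a smooth manifold this is smoothness into
  \<open>std_atlas\<close>, by \<open>smooth_map_std_iff\<close>, in the form in which the calculus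
  rules apply chart by chart.\<close>

definition chart_smooth :: "('a, 'e::euclidean_space) chart set \<Rightarrow> ('a \<Rightarrow> 'b::real_normed_vector) \<Rightarrow> bool" where
  "chart_smooth A f \<longleftrightarrow> (\<forall>\<kappa>\<in>A. smooth_on (coord \<kappa> ` dom_of \<kappa>) (\<lambda>y. f (param \<kappa> y)))"

text \<open>The differential as a map on the coordinate space of a named chart, free of tangent
  vectors and of the choice of a chart.\<close>

definition chart_deriv :: "('a, 'e::euclidean_space) chart \<Rightarrow> ('a \<Rightarrow> 'b::real_normed_vector) \<Rightarrow> 'a \<Rightarrow> 'e \<Rightarrow> 'b" where
  "chart_deriv \<kappa> f x = frechet_derivative (\<lambda>y. f (param \<kappa> y)) (at (coord \<kappa> x))"

lemma chart_smoothD: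
  "chart_smooth A f \<Longrightarrow> \<kappa> \<in> A \<Longrightarrow> smooth_on (coord \<kappa> ` dom_of \<kappa>) (\<lambda>y. f (param \<kappa> y))"
  by (simp add: chart_smooth_def)

lemma chart_deriv_works:
  assumes "chart_smooth A f" "\<kappa> \<in> A" "x \<in> dom_of \<kappa>"
  shows "((\<lambda>y. f (param \<kappa> y)) has_derivative chart_deriv \<kappa> f x) (at (coord \<kappa> x))"
  unfolding chart_deriv_def
  by (rule smooth_on_has_derivative[OF chart_smoothD[OF assms(1,2)]]) (use assms(3) in simp)

context
  fixes X :: "'a topology" and A :: "('a, 'e::euclidean_space) chart set"
  assumes mfd: "smooth_manifold X A"
begin

text \<open>The vector \<open>u\<close> is the image of \<open>w\<close> under the transition
  derivative. Only its existence is recorded: orthogonality to all derivatives taken in one chart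
  then passes to every other chart at the point.\<close>

lemma chart_deriv_change:
  assumes "chart_smooth A f" "\<kappa> \<in> A" "\<kappa>' \<in> A" "x \<in> dom_of \<kappa>" "x \<in> dom_of \<kappa>'"
  obtains u where "chart_deriv \<kappa> f x w = chart_deriv \<kappa>' f x u"
proof -
  note D = frechet_derivative_at[OF derivative_change_chart[OF mfd assms(2-5)
        chart_deriv_works[OF assms(1,3,5)]]]
  show ?thesis
    by (rule that, subst chart_deriv_def, subst D[symmetric]) (rule refl)
qed

text \<open>Every coordinate vector comes from a tangent vector, and every tangent vector has
  components in each chart at its point. The predicate \<open>P\<close> is left open so as to cover
  both the envelope condition and the creative condition.\<close>

lemma tangent_all_iff:
  assumes f: "chart_smooth A f" and g: "chart_smooth A g"
  shows "(\<forall>x\<in>topspace X. \<forall>v\<in>tangent_space A x. P x (differential A x f v) (differential A x g v))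
    \<longleftrightarrow> (\<forall>\<kappa>\<in>A. \<forall>x\<in>dom_of \<kappa>. \<forall>w. P x (chart_deriv \<kappa> f x w) (chart_deriv \<kappa> g x w))"
proof -
  have D: "differential A x f v = chart_deriv \<kappa> f x (v \<kappa>)" "differential A x g v = chart_deriv \<kappa> g x (v \<kappa>)"
    if "v \<in> tangent_space A x" "\<kappa> \<in> A" "x \<in> dom_of \<kappa>" for v \<kappa> x
    unfolding chart_deriv_def
    by (rule differential_chart[OF mfd that chart_smoothD[OF f]], assumption)
      (rule differential_chart[OF mfd that chart_smoothD[OF g]], assumption)
  show ?thesis
  proof (intro iffI ballI allI)
    fix \<kappa> x w
    assume *: "\<forall>x\<in>topspace X. \<forall>v\<in>tangent_space A x. P x (differential A x f v) (differential A x g v)"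
      and \<kappa>: "\<kappa> \<in> A" "x \<in> dom_of \<kappa>"
    obtain v where v: "v \<in> tangent_space A x" "v \<kappa> = w"
      using tangent_vector_exists[OF mfd \<kappa>] .
    have "P x (differential A x f v) (differential A x g v)"
      using * v(1) atlas_dom_subset[OF mfd \<kappa>(1)] \<kappa>(2) by blast
    then show "P x (chart_deriv \<kappa> f x w) (chart_deriv \<kappa> g x w)"
      unfolding D[OF v(1) \<kappa>] v(2) .
  next
    fix x v
    assume *: "\<forall>\<kappa>\<in>A. \<forall>x\<in>dom_of \<kappa>. \<forall>w. P x (chart_deriv \<kappa> f x w) (chart_deriv \<kappa> g x w)"
      and x: "x \<in> topspace X" and v: "v \<in> tangent_space A x"
    obtain \<kappa> where \<kappa>: "\<kappa> \<in> A" "x \<in> dom_of \<kappa>"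
      using atlas_cover[OF mfd x] by blast
    show "P x (differential A x f v) (differential A x g v)"
      unfolding D[OF v \<kappa>] using * \<kappa> by blast
  qed
qed

lemma chart_deriv_inner:
  fixes f g :: "'a \<Rightarrow> 'b::real_inner"
  assumes "chart_smooth A f" "chart_smooth A g"
    and "\<And>z. z \<in> topspace X \<Longrightarrow> f z \<bullet> g z = \<gamma> z" and \<kappa>: "\<kappa> \<in> A" "x \<in> dom_of \<kappa>"
  shows "chart_deriv \<kappa> \<gamma> x w = f x \<bullet> chart_deriv \<kappa> g x w + chart_deriv \<kappa> f x w \<bullet> g x"
proof -
  have "f (param \<kappa> y) \<bullet> g (param \<kappa> y) = \<gamma> (param \<kappa> y)" if "y \<in> coord \<kappa> ` dom_of \<kappa>" for y
    by (rule assms(3)) (use param_in_dom[OF that] atlas_dom_subset[OF mfd \<kappa>(1)] in blast)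
  note * = inner_derivative[OF atlas_open[OF mfd \<kappa>(1)] _ this
      chart_deriv_works[OF assms(1) \<kappa>] chart_deriv_works[OF assms(2) \<kappa>], of w]
  show ?thesis
    unfolding chart_deriv_def[of \<kappa> \<gamma>]
    using * \<kappa>(2) atlas_param_coord[OF mfd \<kappa>] by simp
qed

lemma chart_smooth_inner:
  fixes f g :: "'a \<Rightarrow> 'b::real_inner"
  assumes "chart_smooth A f" "chart_smooth A g"
  shows "chart_smooth A (\<lambda>x. f x \<bullet> g x)"
  unfolding chart_smooth_def
  by (intro ballI smooth_on_inner atlas_open[OF mfd] chart_smoothD[OF assms(1)] chart_smoothD[OF assms(2)])

lemma chart_smooth_locally:
  assumes "\<And>x. x \<in> topspace X \<Longrightarrow> \<exists>\<kappa>\<in>A. \<exists>U. openin X U \<and> x \<in> U \<and> U \<subseteq> dom_of \<kappa> \<and>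
    smooth_on (coord \<kappa> ` U) (\<lambda>y. f (param \<kappa> y))"
  shows "chart_smooth A (f :: 'a \<Rightarrow> 'f::euclidean_space)"
proof -
  have "smooth_map X A std_atlas f"
    unfolding smooth_map_def std_atlas_def using assms by (simp add: comp_def)
  then show ?thesis
    unfolding chart_smooth_def smooth_map_std_iff[OF mfd] .
qed

text \<open>The support hypothesis makes the support compact in \<open>X\<close>, hence closed, as
  \<open>X\<close> is Hausdorff.\<close>

lemma chart_smooth_extend_zero:
  fixes H :: "'e \<Rightarrow> 'f::euclidean_space"
  assumes \<kappa>: "\<kappa> \<in> A" and V: "open V" "V \<subseteq> coord \<kappa> ` dom_of \<kappa>"
    and K: "compact K" "K \<subseteq> V" and H: "smooth_on V H" "\<And>y. y \<in> V - K \<Longrightarrow> H y = 0"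
  shows "chart_smooth A (\<lambda>x. if x \<in> param \<kappa> ` V then H (coord \<kappa> x) else 0)"
proof (rule chart_smooth_locally)
  let ?g = "\<lambda>x. if x \<in> param \<kappa> ` V then H (coord \<kappa> x) else 0"
  let ?P = "param \<kappa> ` V" and ?C = "param \<kappa> ` K"
  have P: "openin X ?P"
    by (rule openin_param_image[OF atlas_chart[OF mfd \<kappa>] V])
  have cp: "coord \<kappa> (param \<kappa> y) = y" if "y \<in> V" for y
    by (rule coord_param) (use that V(2) in blast)
  have "compactin X ?C"
    by (rule compactin_param_image[OF atlas_chart[OF mfd \<kappa>] K(1)]) (use K(2) V(2) in blast)
  then have "closedin X ?C"
    by (rule compactin_imp_closedin[rotated]) (use mfd in \<open>simp add: smooth_manifold_def\<close>)
  then have C: "openin X (topspace X - ?C)"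
    by blast
  fix x assume x: "x \<in> topspace X"
  show "\<exists>\<kappa>\<in>A. \<exists>U. openin X U \<and> x \<in> U \<and> U \<subseteq> dom_of \<kappa> \<and> smooth_on (coord \<kappa> ` U) (\<lambda>y. ?g (param \<kappa> y))"
  proof (cases "x \<in> ?P")
    case True
    have "(\<lambda>y. coord \<kappa> (param \<kappa> y)) ` V = (\<lambda>y. y) ` V"
      by (rule image_cong[OF refl cp])
    then have "coord \<kappa> ` ?P = V"
      by (simp only: image_image image_ident)
    moreover have "smooth_on V (\<lambda>y. ?g (param \<kappa> y))"
      by (rule smooth_on_cong[OF H(1) V(1)]) (simp only: cp imageI if_True)
    moreover have "?P \<subseteq> dom_of \<kappa>"
      by (rule image_subsetI, rule param_in_dom) (use V(2) in blast)
    ultimately show ?thesis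
      using \<kappa> P True by (intro bexI[of _ \<kappa>] exI[of _ ?P] conjI) simp_all
  next
    case False
    obtain \<kappa>' where \<kappa>': "\<kappa>' \<in> A" "x \<in> dom_of \<kappa>'"
      using atlas_cover[OF mfd x] by blast
    \<comment> \<open>Away from \<open>?C\<close> the map is zero, also on the part of
      \<open>?P\<close> outside \<open>?C\<close>. So on this open set it is constant, even where
      \<open>?U\<close> meets the boundary of \<open>?P\<close>.\<close>
    let ?U = "dom_of \<kappa>' \<inter> (topspace X - ?C)"
    have zero: "0 = ?g z" if "z \<in> ?U" for z
    proof (cases "z \<in> ?P")
      case True
      then obtain y where y: "y \<in> V" "z = param \<kappa> y"
        by blast
      then have "y \<in> V - K"
        using that by blast
      then have "H y = 0"
        by (rule H(2))
      then show ?thesis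
        unfolding y(2) cp[OF y(1)] by simp
    qed simp
    have "smooth_on (coord \<kappa>' ` ?U) (\<lambda>y. ?g (param \<kappa>' y))"
    proof (rule smooth_on_cong[OF smooth_on_const[of _ 0] open_overlap[OF mfd \<kappa>'(1) C]])
      fix y assume "y \<in> coord \<kappa>' ` ?U"
      then obtain z where z: "z \<in> ?U" "y = coord \<kappa>' z"
        by blast
      then have *: "param \<kappa>' y = z"
        using atlas_param_coord[OF mfd \<kappa>'(1)] by simp
      show "0 = ?g (param \<kappa>' y)"
        unfolding * by (rule zero[OF z(1)])
    qed
    moreover have "openin X ?U"
      by (rule openin_Int[OF atlas_dom[OF mfd \<kappa>'(1)] C])
    moreover have "x \<in> ?U"
      using x \<kappa>'(2) False K(2) by blast
    ultimately show ?thesis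
      by (intro bexI[OF _ \<kappa>'(1)] exI[of _ ?U] conjI Int_lower1)
  qed
qed

text \<open>Composing the coordinate expression of \<open>\<nu>\<close> with the smooth
  parametrization of the sphere recovers \<open>\<nu>\<close> as a smooth map into the ambient
  space.\<close>

lemma sphere_map_chart_smooth:
  fixes \<nu> :: "'a \<Rightarrow> real^'m"
  assumes "smooth_map X A (sphere_atlas :: (real^'m, real^'n) chart set) \<nu>"
  shows "chart_smooth A \<nu>"
proof (rule chart_smooth_locally)
  fix x assume "x \<in> topspace X"
  then obtain \<kappa> \<beta> U where \<kappa>: "\<kappa> \<in> A" and \<beta>: "\<beta> \<in> (sphere_atlas :: (real^'m, real^'n) chart set)"
    and U: "openin X U" "x \<in> U" "U \<subseteq> dom_of \<kappa>" "\<nu> ` U \<subseteq> dom_of \<beta>"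
    and s: "smooth_on (coord \<kappa> ` U) (coord \<beta> \<circ> \<nu> \<circ> param \<kappa>)"
    using assms unfolding smooth_map_def by blast
  have S: "open (coord \<kappa> ` U)"
    by (rule open_coord_image[OF atlas_chart[OF mfd \<kappa>] U(1,3)])
  have \<nu>: "\<nu> (param \<kappa> y) \<in> dom_of \<beta>" if "y \<in> coord \<kappa> ` U" for y
    using that U(3,4) atlas_param_coord[OF mfd \<kappa>] by fastforce
  have "smooth_on (coord \<kappa> ` U) (\<lambda>y. param \<beta> ((coord \<beta> \<circ> \<nu> \<circ> param \<kappa>) y))"
    by (rule smooth_on_compose[OF S sphere_chart(3)[OF \<beta>] _ sphere_chart(4)[OF \<beta>] s])
      (use \<nu> in auto)
  then have "smooth_on (coord \<kappa> ` U) (\<lambda>y. \<nu> (param \<kappa> y))"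
    by (rule smooth_on_cong[OF _ S]) (simp add: param_coord[OF sphere_chart(1)[OF \<beta>] \<nu>])
  then show "\<exists>\<kappa>\<in>A. \<exists>U. openin X U \<and> x \<in> U \<and> U \<subseteq> dom_of \<kappa> \<and> smooth_on (coord \<kappa> ` U) (\<lambda>y. \<nu> (param \<kappa> y))"
    using \<kappa> U by blast
qed

end

section \<open>Envelopes\<close>

text \<open>\<open>L\<close> extends \<open>\<alpha>\<close> to the ambient space by orthogonal
  projection along \<open>p\<close> and by the value \<open>c\<close> at \<open>p\<close>; then
  \<open>adjoint L 1\<close> is the vector representing \<open>L\<close>. The number
  \<open>c\<close> leaves the normal component free to be prescribed.\<close>

lemma sphere_cotangent_representation:
  fixes p :: "real^'m"
  assumes \<alpha>: "\<alpha> \<in> sphere_cotangent p" and p: "p \<bullet> p = 1"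
  shows "\<exists>u. u \<bullet> p = c \<and> (\<forall>w\<in>sphere_tangent p. u \<bullet> w = \<alpha> w)"
proof -
  define L where "L w = \<alpha> (w - (w \<bullet> p) *\<^sub>R p) + c * (w \<bullet> p)" for w
  have t: "w - (w \<bullet> p) *\<^sub>R p \<in> sphere_tangent p" for w
    by (simp add: sphere_tangent_def inner_diff_left p)
  have add: "\<alpha> (v + w) = \<alpha> v + \<alpha> w" and scale: "\<alpha> (r *\<^sub>R v) = r * \<alpha> v"
    if "v \<in> sphere_tangent p" "w \<in> sphere_tangent p" for v w r
    using \<alpha> that unfolding sphere_cotangent_def by blast+
  have "linear L"
  proof (rule linearI)
    fix v w r
    have "(v + w) - ((v + w) \<bullet> p) *\<^sub>R p = (v - (v \<bullet> p) *\<^sub>R p) + (w - (w \<bullet> p) *\<^sub>R p)"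
      by (simp add: inner_add_left scaleR_add_left)
    then show "L (v + w) = L v + L w"
      unfolding L_def by (simp only: add[OF t t] inner_add_left distrib_left)
    have "(r *\<^sub>R v) - ((r *\<^sub>R v) \<bullet> p) *\<^sub>R p = r *\<^sub>R (v - (v \<bullet> p) *\<^sub>R p)"
      by (simp add: scaleR_diff_right)
    then show "L (r *\<^sub>R v) = r *\<^sub>R L v"
      unfolding L_def by (simp only: scale[OF t t] inner_scaleR_left) (simp add: distrib_left)
  qed
  then have u: "adjoint L 1 \<bullet> w = L w" for w
    using adjoint_works[of L w 1] by (simp add: inner_commute)
  have "\<alpha> 0 = 0"
    using scale[of 0 0 0] by (simp add: sphere_tangent_def)
  then have "adjoint L 1 \<bullet> p = c"
    unfolding u L_def by (simp add: p)
  moreover have "adjoint L 1 \<bullet> w = \<alpha> w" if "w \<in> sphere_tangent p" for w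
    using that unfolding u L_def by (simp add: sphere_tangent_def)
  ultimately show ?thesis
    by blast
qed

context
  fixes X :: "'a topology" and A :: "('a, real^'n) chart set" and \<phi> \<nu> :: "'a \<Rightarrow> real^'m"
  assumes mfd: "smooth_manifold X A"
    and \<phi>: "chart_smooth A \<phi>"
    and sph: "smooth_map X A (sphere_atlas :: (real^'m, real^'n) chart set) \<nu>"
    and unit: "\<And>x. x \<in> topspace X \<Longrightarrow> norm (\<nu> x) = 1"
    and card: "CARD('m) = CARD('n) + 1"
begin

lemma chart_smooth_\<nu>: "chart_smooth A \<nu>"
  by (rule sphere_map_chart_smooth[OF mfd sph])

lemma dom_topspace: "\<kappa> \<in> A \<Longrightarrow> x \<in> dom_of \<kappa> \<Longrightarrow> x \<in> topspace X"
  using atlas_dom_subset[OF mfd] by blast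

text \<open>Under the incidence condition the product rule trades the derivative of \<open>f\<close>
  for that of \<open>\<nu>\<close>. In this form both conditions are affine in the values of
  \<open>f\<close>, so perturbing or comparing envelopes never involves derivatives of the
  difference.\<close>

lemma is_envelope_iff:
  "is_envelope X A \<phi> \<nu> f \<longleftrightarrow> f \<in> extensional (topspace X) \<and> chart_smooth A f \<and>
    (\<forall>x\<in>topspace X. f x \<bullet> \<nu> x = \<phi> x \<bullet> \<nu> x) \<and>
    (\<forall>\<kappa>\<in>A. \<forall>x\<in>dom_of \<kappa>. \<forall>w. chart_deriv \<kappa> (\<lambda>x. \<phi> x \<bullet> \<nu> x) x w = f x \<bullet> chart_deriv \<kappa> \<nu> x w)"
proof -
  have "(\<forall>x\<in>topspace X. \<forall>v\<in>tangent_space A x. differential A x f v \<bullet> \<nu> x = 0) \<longleftrightarrow>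
      (\<forall>\<kappa>\<in>A. \<forall>x\<in>dom_of \<kappa>. \<forall>w. chart_deriv \<kappa> (\<lambda>x. \<phi> x \<bullet> \<nu> x) x w = f x \<bullet> chart_deriv \<kappa> \<nu> x w)"
    if f: "chart_smooth A f" and eq: "\<forall>x\<in>topspace X. f x \<bullet> \<nu> x = \<phi> x \<bullet> \<nu> x"
  proof -
    have "chart_deriv \<kappa> (\<lambda>x. \<phi> x \<bullet> \<nu> x) x w = f x \<bullet> chart_deriv \<kappa> \<nu> x w
        \<longleftrightarrow> chart_deriv \<kappa> f x w \<bullet> \<nu> x = 0" if "\<kappa> \<in> A" "x \<in> dom_of \<kappa>" for \<kappa> x w
    proof -
      have "chart_deriv \<kappa> (\<lambda>x. \<phi> x \<bullet> \<nu> x) x w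
          = f x \<bullet> chart_deriv \<kappa> \<nu> x w + chart_deriv \<kappa> f x w \<bullet> \<nu> x"
        by (rule chart_deriv_inner[OF mfd f chart_smooth_\<nu> _ that]) (use eq in blast)
      then show ?thesis
        by simp
    qed
    then show ?thesis
      unfolding tangent_all_iff[OF mfd f f, of "\<lambda>x a b. a \<bullet> \<nu> x = 0"] by simp
  qed
  moreover have "f x \<in> hyperplane (\<phi> x) (\<nu> x) \<longleftrightarrow> f x \<bullet> \<nu> x = \<phi> x \<bullet> \<nu> x" for x
    by (simp add: hyperplane_def inner_diff_left)
  ultimately show ?thesis
    unfolding is_envelope_def smooth_map_std_iff[OF mfd] chart_smooth_def[symmetric] by blast
qed

lemma creative_iff:
  "creative X A \<phi> \<nu> \<longleftrightarrow> (\<exists>\<omega>. (\<forall>x\<in>topspace X. \<omega> x \<in> sphere_cotangent (\<nu> x)) \<and>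
    smooth_map X A (sphere_cotangent_atlas ::
      ((real^'m) \<times> (real^'m \<Rightarrow> real), (real^'n) \<times> (real^'n)) chart set) (\<lambda>x. (\<nu> x, \<omega> x)) \<and>
    (\<forall>\<kappa>\<in>A. \<forall>x\<in>dom_of \<kappa>. \<forall>w.
      chart_deriv \<kappa> (\<lambda>x. \<phi> x \<bullet> \<nu> x) x w = \<omega> x (chart_deriv \<kappa> \<nu> x w)))"
  unfolding creative_def
    tangent_all_iff[OF mfd chart_smooth_inner[OF mfd \<phi> chart_smooth_\<nu>] chart_smooth_\<nu>, of "\<lambda>x a b. a = \<omega> x b" for \<omega>] ..

lemma \<nu>_chart:
  assumes "x \<in> topspace X"
  obtains \<kappa> U and \<beta> :: "(real^'m, real^'n) chart"
  where "\<kappa> \<in> A" "\<beta> \<in> sphere_atlas" "openin X U" "x \<in> U" "U \<subseteq> dom_of \<kappa>" "\<nu> ` U \<subseteq> dom_of \<beta>"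
    "smooth_on (coord \<kappa> ` U) (\<lambda>y. coord \<beta> (\<nu> (param \<kappa> y)))"
  using sph assms unfolding smooth_map_def comp_def by blast

lemma chart_deriv_\<nu>_orthogonal:
  assumes "\<kappa> \<in> A" "x \<in> dom_of \<kappa>"
  shows "chart_deriv \<kappa> \<nu> x w \<bullet> \<nu> x = 0"
proof -
  have y: "coord \<kappa> x \<in> coord \<kappa> ` dom_of \<kappa>"
    using assms by simp
  have "norm (\<nu> (param \<kappa> z)) = 1" if "z \<in> coord \<kappa> ` dom_of \<kappa>" for z
    using unit[OF dom_topspace[OF assms(1) param_in_dom[OF that]]] .
  from unit_vector_derivative[OF atlas_open[OF mfd assms(1)] y this chart_deriv_works[OF chart_smooth_\<nu> assms]]
  show ?thesis
    unfolding atlas_param_coord[OF mfd assms] .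
qed

section \<open>From envelopes to creating forms\<close>

lemma envelope_imp_creative:
  assumes "is_envelope X A \<phi> \<nu> f"
  shows "creative X A \<phi> \<nu>"
  unfolding creative_iff
proof (intro exI[of _ "\<lambda>x. restrict (\<lambda>w. f x \<bullet> w) (sphere_tangent (\<nu> x))"] conjI ballI allI)
  let ?\<omega> = "\<lambda>x. restrict (\<lambda>w. f x \<bullet> w) (sphere_tangent (\<nu> x))"
  have f: "chart_smooth A f"
    and D: "\<And>\<kappa> x w. \<kappa> \<in> A \<Longrightarrow> x \<in> dom_of \<kappa> \<Longrightarrow>
      chart_deriv \<kappa> (\<lambda>x. \<phi> x \<bullet> \<nu> x) x w = f x \<bullet> chart_deriv \<kappa> \<nu> x w"
    using assms unfolding is_envelope_iff by blast+
  show cot: "?\<omega> x \<in> sphere_cotangent (\<nu> x)" if "x \<in> topspace X" for x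
    by (simp add: sphere_cotangent_def sphere_tangent_def inner_add_left inner_add_right)
  show "chart_deriv \<kappa> (\<lambda>x. \<phi> x \<bullet> \<nu> x) x w = ?\<omega> x (chart_deriv \<kappa> \<nu> x w)"
    if "\<kappa> \<in> A" "x \<in> dom_of \<kappa>" for \<kappa> x w
    using D[OF that] chart_deriv_\<nu>_orthogonal[OF that] by (simp add: sphere_tangent_def)
  show "smooth_map X A (sphere_cotangent_atlas ::
      ((real^'m) \<times> (real^'m \<Rightarrow> real), (real^'n) \<times> (real^'n)) chart set) (\<lambda>x. (\<nu> x, ?\<omega> x))"
    unfolding smooth_map_def
  proof
    fix x assume "x \<in> topspace X"
    then obtain \<kappa> U and \<beta> :: "(real^'m, real^'n) chart"
      where \<kappa>: "\<kappa> \<in> A" and \<beta>: "\<beta> \<in> sphere_atlas"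
        and U: "openin X U" "x \<in> U" "U \<subseteq> dom_of \<kappa>" "\<nu> ` U \<subseteq> dom_of \<beta>"
        and s: "smooth_on (coord \<kappa> ` U) (\<lambda>y. coord \<beta> (\<nu> (param \<kappa> y)))"
      using \<nu>_chart by metis
    have S: "open (coord \<kappa> ` U)"
      by (rule open_coord_image[OF atlas_chart[OF mfd \<kappa>] U(1,3)])
    have U': "param \<kappa> y \<in> U" if "y \<in> coord \<kappa> ` U" for y
      using that U(3) atlas_param_coord[OF mfd \<kappa>] by force
    have \<nu>U: "\<nu> (param \<kappa> y) \<in> dom_of \<beta>" if "y \<in> coord \<kappa> ` U" for y
      using U'[OF that] U(4) by blast
    \<comment> \<open>\<open>?e y i\<close> is the i-th coordinate vector of the sphere chart at the
      value of \<open>\<nu>\<close>, so \<open>?F\<close> is the expression of \<open>\<nu>\<close>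
      and \<open>?\<omega>\<close> in the induced cotangent chart.\<close>
    let ?e = "\<lambda>y i. frechet_derivative (param \<beta>) (at (coord \<beta> (\<nu> (param \<kappa> y)))) (axis i 1)"
    let ?F = "\<lambda>y. (coord \<beta> (\<nu> (param \<kappa> y)), \<chi> i. f (param \<kappa> y) \<bullet> ?e y i)"
    have "smooth_on (coord \<kappa> ` U) ?F"
    proof (intro smooth_on_Pair smooth_on_vec smooth_on_inner S s)
      show "smooth_on (coord \<kappa> ` U) (\<lambda>y. f (param \<kappa> y))"
        by (rule smooth_on_subset[OF chart_smoothD[OF f \<kappa>]]) (use U(3) in blast)
      show "smooth_on (coord \<kappa> ` U) (\<lambda>y. ?e y i)" for i
        by (rule smooth_on_compose[OF S sphere_chart(3)[OF \<beta>] _ smooth_on_derivative[OF sphere_chart(4)[OF \<beta>]] s])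
          (use \<nu>U in blast)
    qed
    \<comment> \<open>The coordinate vectors are tangent to the sphere; hence the restricted
      functional takes its inner product value on them and not the default value.\<close>
    moreover have "?F y = (coord (cotangent_chart \<beta>) \<circ> (\<lambda>x. (\<nu> x, ?\<omega> x)) \<circ> param \<kappa>) y"
      if "y \<in> coord \<kappa> ` U" for y
      using sphere_chart_tangent[OF \<beta> \<nu>U[OF that]]
      by (simp add: cotangent_chart_def sphere_tangent_def)
    ultimately have "smooth_on (coord \<kappa> ` U) (coord (cotangent_chart \<beta>) \<circ> (\<lambda>x. (\<nu> x, ?\<omega> x)) \<circ> param \<kappa>)"
      by (rule smooth_on_cong[OF _ S])
    moreover have "(\<lambda>x. (\<nu> x, ?\<omega> x)) ` U \<subseteq> dom_of (cotangent_chart \<beta>)"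
    proof (rule image_subsetI)
      fix z assume z: "z \<in> U"
      then have "z \<in> topspace X"
        using U(1) openin_subset by blast
      then show "(\<nu> z, ?\<omega> z) \<in> dom_of (cotangent_chart \<beta>)"
        using cot z U(4) unfolding cotangent_chart_def by auto
    qed
    moreover have "cotangent_chart \<beta> \<in> sphere_cotangent_atlas"
      using \<beta> by (simp add: sphere_cotangent_atlas_def)
    ultimately show "\<exists>\<kappa>\<in>A. \<exists>\<beta>\<in>sphere_cotangent_atlas ::
        ((real^'m) \<times> (real^'m \<Rightarrow> real), (real^'n) \<times> (real^'n)) chart set. \<exists>U. openin X U \<and> x \<in> U \<and>
        U \<subseteq> dom_of \<kappa> \<and> (\<lambda>x. (\<nu> x, ?\<omega> x)) ` U \<subseteq> dom_of \<beta> \<and>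
        smooth_on (coord \<kappa> ` U) (coord \<beta> \<circ> (\<lambda>x. (\<nu> x, ?\<omega> x)) \<circ> param \<kappa>)"
      using \<kappa> U(1-3) by (intro bexI[of _ \<kappa>] bexI[of _ "cotangent_chart \<beta>"] exI[of _ U] conjI)
  qed
qed

section \<open>Density of regular points and uniqueness\<close>

lemma regular_point_chart:
  assumes "\<kappa> \<in> A" "x \<in> dom_of \<kappa>"
  shows "regular_point A \<nu> x \<longleftrightarrow> dim (range (chart_deriv \<kappa> \<nu> x)) = CARD('n)"
  by (simp only: regular_point_def chart_deriv_def
      differential_image_chart[OF mfd assms chart_smoothD[OF chart_smooth_\<nu>]])

lemma envelopes_agree_at_regular_point:
  assumes "is_envelope X A \<phi> \<nu> f" "is_envelope X A \<phi> \<nu> g" and x: "x \<in> topspace X" "regular_point A \<nu> x"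
  shows "f x = g x"
proof -
  obtain \<kappa> where \<kappa>: "\<kappa> \<in> A" "x \<in> dom_of \<kappa>"
    using atlas_cover[OF mfd x(1)] by blast
  have d: "dim (range (chart_deriv \<kappa> \<nu> x)) = CARD('n)"
    using x(2) unfolding regular_point_chart[OF \<kappa>] .
  have n: "\<nu> x \<bullet> \<nu> x = 1"
    using unit[OF x(1)] by (simp add: dot_square_norm)
  have "f x \<bullet> \<nu> x = \<phi> x \<bullet> \<nu> x" "g x \<bullet> \<nu> x = \<phi> x \<bullet> \<nu> x"
    and "chart_deriv \<kappa> (\<lambda>x. \<phi> x \<bullet> \<nu> x) x w = f x \<bullet> chart_deriv \<kappa> \<nu> x w"
      "chart_deriv \<kappa> (\<lambda>x. \<phi> x \<bullet> \<nu> x) x w = g x \<bullet> chart_deriv \<kappa> \<nu> x w" for w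
    using assms(1,2) x(1) \<kappa> unfolding is_envelope_iff by blast+
  then have "(f x - g x) \<bullet> \<nu> x = 0" "(f x - g x) \<bullet> chart_deriv \<kappa> \<nu> x w = 0" for w
    unfolding inner_diff_left by simp_all
  then have "f x - g x = 0"
    by (rule orthogonal_to_hyperplane_and_normal[OF card d n chart_deriv_\<nu>_orthogonal[OF \<kappa>]])
  then show ?thesis
    by simp
qed

lemma dense_imp_envelope_unique:
  assumes dense: "X closure_of {x \<in> topspace X. regular_point A \<nu> x} = topspace X"
    and fg: "is_envelope X A \<phi> \<nu> f" "is_envelope X A \<phi> \<nu> g"
  shows "f = g"
proof (rule extensionalityI[of _ "topspace X"])
  show "f \<in> extensional (topspace X)" "g \<in> extensional (topspace X)"
    using fg by (simp_all add: is_envelope_def)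
  fix x assume x: "x \<in> topspace X"
  show "f x = g x"
  proof (rule ccontr)
    assume "f x \<noteq> g x"
    obtain \<kappa> where \<kappa>: "\<kappa> \<in> A" "x \<in> dom_of \<kappa>"
      using atlas_cover[OF mfd x] by blast
    \<comment> \<open>The set where the envelopes differ is formed in coordinates, where continuity
      is at hand; \<open>param\<close> turns it into an open set around \<open>x\<close>, which must
      contain a regular point.\<close>
    define h where "h y = f (param \<kappa> y) - g (param \<kappa> y)" for y
    define V where "V = coord \<kappa> ` dom_of \<kappa> \<inter> h -` (- {0})"
    have "continuous_on (coord \<kappa> ` dom_of \<kappa>) h"
      unfolding h_def
      by (intro continuous_on_diff smooth_on_imp_continuous_on chart_smoothD[OF _ \<kappa>(1)])
        (use fg in \<open>simp_all add: is_envelope_iff\<close>)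
    then have V: "open V"
      unfolding V_def by (intro continuous_open_preimage atlas_open[OF mfd \<kappa>(1)]) auto
    have "openin X (param \<kappa> ` V)"
      by (rule openin_param_image[OF atlas_chart[OF mfd \<kappa>(1)] V]) (simp add: V_def)
    moreover have "x \<in> param \<kappa> ` V"
      using \<kappa> \<open>f x \<noteq> g x\<close> atlas_param_coord[OF mfd \<kappa>]
      by (intro image_eqI[of _ _ "coord \<kappa> x"]) (simp_all add: V_def h_def)
    moreover have "x \<in> X closure_of {x \<in> topspace X. regular_point A \<nu> x}"
      using x dense by simp
    ultimately obtain z where z: "z \<in> topspace X" "regular_point A \<nu> z" "z \<in> param \<kappa> ` V"
      unfolding in_closure_of by blast
    then have "f z \<noteq> g z"
      by (auto simp: V_def h_def)
    then show False
      using envelopes_agree_at_regular_point[OF fg z(1,2)] by simp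
  qed
qed

lemma envelope_unique_imp_dense:
  assumes f: "is_envelope X A \<phi> \<nu> f" and uniq: "\<And>g. is_envelope X A \<phi> \<nu> g \<Longrightarrow> g = f"
  shows "X closure_of {x \<in> topspace X. regular_point A \<nu> x} = topspace X"
proof (rule ccontr)
  assume "X closure_of {x \<in> topspace X. regular_point A \<nu> x} \<noteq> topspace X"
  then obtain x0 T where x0: "x0 \<in> topspace X" "openin X T" "x0 \<in> T"
    and T: "\<And>x. x \<in> T \<Longrightarrow> x \<in> topspace X \<Longrightarrow> \<not> regular_point A \<nu> x"
    using closure_of_subset_topspace[of X "{x \<in> topspace X. regular_point A \<nu> x}"]
    unfolding closure_of_def by blast
  obtain \<kappa> where \<kappa>: "\<kappa> \<in> A" "x0 \<in> dom_of \<kappa>"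
    using atlas_cover[OF mfd x0(1)] by blast
  define V where "V = coord \<kappa> ` (dom_of \<kappa> \<inter> T)"
  have V: "open V" "V \<noteq> {}" "V \<subseteq> coord \<kappa> ` dom_of \<kappa>"
    using open_overlap[OF mfd \<kappa>(1) x0(2)] \<kappa>(2) x0(3) unfolding V_def by blast+
  let ?n = "\<lambda>y. \<nu> (param \<kappa> y)"
  define G where "G = insert ?n (range (\<lambda>w y. frechet_derivative ?n (at y) w))"
  have n: "smooth_on V ?n"
    by (rule smooth_on_subset[OF chart_smoothD[OF chart_smooth_\<nu> \<kappa>(1)] V(3)])
  have G: "smooth_on V g" if "g \<in> G" for g
    using that n smooth_on_derivative[OF n] unfolding G_def by blast
  \<comment> \<open>Spanning at \<open>y\<close> would make the corresponding point regular by the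
    dimension count, but that point lies in \<open>T\<close>.\<close>
  have deg: "span ((\<lambda>g. g y) ` G) \<noteq> UNIV" if y: "y \<in> V" for y
  proof
    assume *: "span ((\<lambda>g. g y) ` G) = UNIV"
    obtain x where x: "x \<in> dom_of \<kappa>" "x \<in> T" "y = coord \<kappa> x"
      using y unfolding V_def by blast
    have "(\<lambda>g. g y) ` G = insert (\<nu> x) (range (chart_deriv \<kappa> \<nu> x))"
      unfolding G_def chart_deriv_def x(3) image_insert image_image
      by (simp only: atlas_param_coord[OF mfd \<kappa>(1) x(1)])
    moreover have "linear (chart_deriv \<kappa> \<nu> x)"
      by (rule has_derivative_linear[OF chart_deriv_works[OF chart_smooth_\<nu> \<kappa>(1) x(1)]])
    ultimately have "dim (range (chart_deriv \<kappa> \<nu> x)) = CARD('n)"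
      using span_insert_range_UNIV[OF _ card] * by metis
    then show False
      using T[OF x(2) dom_topspace[OF \<kappa>(1) x(1)]] regular_point_chart[OF \<kappa>(1) x(1)] by simp
  qed
  obtain h a where h: "smooth_on V h" and a: "a \<in> V" "h a \<noteq> 0"
    and orth: "\<And>g y. g \<in> G \<Longrightarrow> y \<in> V \<Longrightarrow> h y \<bullet> g y = 0"
    using smooth_orthogonal_section[OF V(1,2) G deg] by blast
  \<comment> \<open>The closed ball is the compact set required for extension by zero; the bump
    function vanishes already off the open ball.\<close>
  obtain r where r: "r > 0" "cball a r \<subseteq> V"
    using V(1) a(1) open_contains_cball by blast
  obtain \<psi> :: "real^'n \<Rightarrow> real" where \<psi>: "smooth_on UNIV \<psi>" "\<psi> a \<noteq> 0" "\<And>y. y \<notin> ball a r \<Longrightarrow> \<psi> y = 0"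
    using exists_smooth_bump[OF r(1)] by blast
  define H where "H y = \<psi> y *\<^sub>R h y" for y
  define g where "g x = (if x \<in> param \<kappa> ` V then H (coord \<kappa> x) else 0)" for x
  have g: "chart_smooth A g"
    unfolding g_def
  proof (rule chart_smooth_extend_zero[OF mfd \<kappa>(1) V(1,3) compact_cball r(2)])
    show "smooth_on V H"
      unfolding H_def by (rule smooth_on_scaleR[OF V(1) smooth_on_subset[OF \<psi>(1) subset_UNIV] h])
    show "H y = 0" if "y \<in> V - cball a r" for y
      using \<psi>(3)[of y] that by (simp add: H_def)
  qed
  have g0: "g x = 0 \<or> (x \<in> dom_of \<kappa> \<and> coord \<kappa> x \<in> V \<and> g x = \<psi> (coord \<kappa> x) *\<^sub>R h (coord \<kappa> x))" for x
  proof (cases "x \<in> param \<kappa> ` V")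
    case True
    then obtain y where y: "y \<in> V" "x = param \<kappa> y"
      by blast
    have "y \<in> coord \<kappa> ` dom_of \<kappa>"
      using y(1) V(3) by blast
    then have "x \<in> dom_of \<kappa>" "coord \<kappa> x = y"
      unfolding y(2) by (rule param_in_dom, rule coord_param)
    then show ?thesis
      using True y(1) by (simp add: g_def H_def)
  qed (simp add: g_def)
  have g\<nu>: "g x \<bullet> \<nu> x = 0" for x
    using g0[of x]
  proof
    assume *: "x \<in> dom_of \<kappa> \<and> coord \<kappa> x \<in> V \<and> g x = \<psi> (coord \<kappa> x) *\<^sub>R h (coord \<kappa> x)"
    have "h (coord \<kappa> x) \<bullet> ?n (coord \<kappa> x) = 0"
      by (rule orth[of ?n]) (use * in \<open>simp_all add: G_def\<close>)
    then show ?thesis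
      using * atlas_param_coord[OF mfd \<kappa>(1)] by simp
  qed simp
  \<comment> \<open>The factor \<open>h\<close> is orthogonal to the derivatives taken in
    \<open>\<kappa>\<close>; a direction in \<open>\<kappa>'\<close> is first replaced by one in
    \<open>\<kappa>\<close>.\<close>
  have gD: "g x \<bullet> chart_deriv \<kappa>' \<nu> x w = 0" if \<kappa>': "\<kappa>' \<in> A" "x \<in> dom_of \<kappa>'" for \<kappa>' x w
    using g0[of x]
  proof
    assume *: "x \<in> dom_of \<kappa> \<and> coord \<kappa> x \<in> V \<and> g x = \<psi> (coord \<kappa> x) *\<^sub>R h (coord \<kappa> x)"
    then obtain u where u: "chart_deriv \<kappa>' \<nu> x w = chart_deriv \<kappa> \<nu> x u"
      using chart_deriv_change[OF mfd chart_smooth_\<nu> \<kappa>'(1) \<kappa>(1) \<kappa>'(2)] by blast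
    have "h (coord \<kappa> x) \<bullet> frechet_derivative ?n (at (coord \<kappa> x)) u = 0"
      by (rule orth[of "\<lambda>y. frechet_derivative ?n (at y) u"]) (use * in \<open>simp_all add: G_def\<close>)
    then show ?thesis
      using * unfolding u unfolding chart_deriv_def by simp
  qed simp
  define f' where "f' = restrict (\<lambda>x. f x + g x) (topspace X)"
  have f': "f' x = f x + g x" if "x \<in> topspace X" for x
    unfolding f'_def by (rule restrict_apply'[OF that])
  have "is_envelope X A \<phi> \<nu> f'"
    unfolding is_envelope_iff
  proof (intro conjI ballI allI)
    show "f' \<in> extensional (topspace X)"
      by (simp add: f'_def)
    show "chart_smooth A f'"
      unfolding chart_smooth_def
    proof
      fix \<kappa>' assume \<kappa>': "\<kappa>' \<in> A"
      have "smooth_on (coord \<kappa>' ` dom_of \<kappa>') (\<lambda>y. f (param \<kappa>' y) + g (param \<kappa>' y))"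
        using f by (intro smooth_on_add chart_smoothD[OF _ \<kappa>'] g atlas_open[OF mfd \<kappa>'])
          (simp add: is_envelope_iff)
      then show "smooth_on (coord \<kappa>' ` dom_of \<kappa>') (\<lambda>y. f' (param \<kappa>' y))"
        by (rule smooth_on_cong[OF _ atlas_open[OF mfd \<kappa>']])
          (rule f'[symmetric, OF dom_topspace[OF \<kappa>' param_in_dom]])
    qed
    show "f' x \<bullet> \<nu> x = \<phi> x \<bullet> \<nu> x" if "x \<in> topspace X" for x
      using f that g\<nu>[of x] unfolding is_envelope_iff by (simp add: f' inner_add_left)
    show "chart_deriv \<kappa>' (\<lambda>x. \<phi> x \<bullet> \<nu> x) x w = f' x \<bullet> chart_deriv \<kappa>' \<nu> x w"
      if "\<kappa>' \<in> A" "x \<in> dom_of \<kappa>'" for \<kappa>' x w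
      using f that gD[OF that, of w] dom_topspace[OF that] unfolding is_envelope_iff
      by (simp add: f' inner_add_left)
  qed
  then have "f' = f"
    by (rule uniq)
  \<comment> \<open>At \<open>a\<close> neither the bump function nor \<open>h\<close> vanishes, so
    the new envelope really differs from \<open>f\<close>.\<close>
  have "g (param \<kappa> a) \<noteq> 0"
    using a \<psi>(2) V(3) coord_param[of a \<kappa>] by (auto simp: g_def H_def)
  moreover have "param \<kappa> a \<in> topspace X"
    by (rule dom_topspace[OF \<kappa>(1) param_in_dom]) (use a(1) V(3) in blast)
  ultimately show False
    using f' \<open>f' = f\<close> by force
qed

section \<open>From creating forms to envelopes\<close>

text \<open>The normal component of the envelope and the components of \<open>\<omega>\<close> in a chart of the cotangent bundle
  form an invertible linear system for the envelope, with smooth coefficients.\<close>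

lemma creative_imp_envelope:
  assumes "creative X A \<phi> \<nu>"
  shows "\<exists>f. is_envelope X A \<phi> \<nu> f"
proof -
  obtain \<omega> where cot: "\<And>x. x \<in> topspace X \<Longrightarrow> \<omega> x \<in> sphere_cotangent (\<nu> x)"
    and sm: "smooth_map X A (sphere_cotangent_atlas ::
      ((real^'m) \<times> (real^'m \<Rightarrow> real), (real^'n) \<times> (real^'n)) chart set) (\<lambda>x. (\<nu> x, \<omega> x))"
    and D: "\<And>\<kappa> x w. \<kappa> \<in> A \<Longrightarrow> x \<in> dom_of \<kappa> \<Longrightarrow>
      chart_deriv \<kappa> (\<lambda>x. \<phi> x \<bullet> \<nu> x) x w = \<omega> x (chart_deriv \<kappa> \<nu> x w)"
    using assms unfolding creative_iff by blast
  have n1: "\<nu> x \<bullet> \<nu> x = 1" if "x \<in> topspace X" for x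
    using unit[OF that] by (simp add: dot_square_norm)
  \<comment> \<open>Normal and tangential components determine \<open>u\<close>, so a pointwise
    choice has no freedom that could spoil smoothness.\<close>
  have "\<forall>x\<in>topspace X. \<exists>u. u \<bullet> \<nu> x = \<phi> x \<bullet> \<nu> x \<and> (\<forall>w\<in>sphere_tangent (\<nu> x). u \<bullet> w = \<omega> x w)"
    using sphere_cotangent_representation[OF cot n1] by simp
  then obtain f0 where f0: "\<forall>x\<in>topspace X. f0 x \<bullet> \<nu> x = \<phi> x \<bullet> \<nu> x \<and>
      (\<forall>w\<in>sphere_tangent (\<nu> x). f0 x \<bullet> w = \<omega> x w)"
    by (rule bchoice[THEN exE])
  define f where "f = restrict f0 (topspace X)"
  have f\<nu>: "f x \<bullet> \<nu> x = \<phi> x \<bullet> \<nu> x"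
    and f\<omega>: "\<And>w. w \<in> sphere_tangent (\<nu> x) \<Longrightarrow> f x \<bullet> w = \<omega> x w"
    if "x \<in> topspace X" for x
    using f0 that by (simp_all add: f_def)
  have "chart_smooth A f"
  proof (rule chart_smooth_locally[OF mfd])
    fix x assume "x \<in> topspace X"
    then obtain \<kappa> \<beta>' U where \<kappa>: "\<kappa> \<in> A"
      and \<beta>': "\<beta>' \<in> (sphere_cotangent_atlas ::
        ((real^'m) \<times> (real^'m \<Rightarrow> real), (real^'n) \<times> (real^'n)) chart set)"
      and U: "openin X U" "x \<in> U" "U \<subseteq> dom_of \<kappa>" and U\<beta>': "(\<lambda>x. (\<nu> x, \<omega> x)) ` U \<subseteq> dom_of \<beta>'"
      and s': "smooth_on (coord \<kappa> ` U) (coord \<beta>' \<circ> (\<lambda>x. (\<nu> x, \<omega> x)) \<circ> param \<kappa>)"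
      using sm unfolding smooth_map_def by blast
    obtain \<beta> :: "(real^'m, real^'n) chart" where \<beta>: "\<beta> \<in> sphere_atlas" "\<beta>' = cotangent_chart \<beta>"
      using \<beta>' unfolding sphere_cotangent_atlas_def by blast
    let ?S = "coord \<kappa> ` U"
    define b where "b y = coord \<beta> (\<nu> (param \<kappa> y))" for y
    define e where "e y i = frechet_derivative (param \<beta>) (at (b y)) (axis i 1)" for y i
    define a where "a y = (\<chi> i. \<omega> (param \<kappa> y) (e y i))" for y
    have S: "open ?S"
      by (rule open_coord_image[OF atlas_chart[OF mfd \<kappa>] U(1,3)])
    have U': "param \<kappa> y \<in> U" if "y \<in> ?S" for y
      using that U(3) atlas_param_coord[OF mfd \<kappa>] by force
    have top: "param \<kappa> y \<in> topspace X" if "y \<in> ?S" for y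
      using U'[OF that] U(1) openin_subset by blast
    have \<nu>U: "\<nu> (param \<kappa> y) \<in> dom_of \<beta>" if "y \<in> ?S" for y
      using U'[OF that] U\<beta>' unfolding \<beta>(2) cotangent_chart_def by auto
    have by_in: "b y \<in> coord \<beta> ` dom_of \<beta>" if "y \<in> ?S" for y
      using \<nu>U[OF that] by (simp add: b_def)
    have p_b: "param \<beta> (b y) = \<nu> (param \<kappa> y)" if "y \<in> ?S" for y
      unfolding b_def by (rule param_coord[OF sphere_chart(1)[OF \<beta>(1)] \<nu>U[OF that]])
    have "smooth_on ?S (\<lambda>y. (b y, a y))"
      using s' unfolding \<beta>(2) cotangent_chart_def comp_def b_def a_def e_def by simp
    from smooth_on_bounded_linear[OF bounded_linear_fst S this]
      smooth_on_bounded_linear[OF bounded_linear_snd S this]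
    have b: "smooth_on ?S b" and a: "smooth_on ?S a"
      by simp_all
    have e: "smooth_on ?S (\<lambda>y. e y i)" for i
      unfolding e_def
      by (rule smooth_on_compose[OF S sphere_chart(3)[OF \<beta>(1)] _ smooth_on_derivative[OF sphere_chart(4)[OF \<beta>(1)]] b])
        (use by_in in blast)
    have tang: "frechet_derivative (param \<beta>) (at (b y)) w \<bullet> \<nu> (param \<kappa> y) = 0" if "y \<in> ?S" for y w
      unfolding b_def by (rule sphere_chart_tangent[OF \<beta>(1) \<nu>U[OF that]])
    \<comment> \<open>The index \<open>k\<close>, arbitrary in \<open>'m\<close>, is reserved for
      the normal row of the square system; \<open>\<sigma>\<close> matches the remaining indices
      with the n coordinate vectors.\<close>
    obtain k :: 'm where True by blast
    have "card (UNIV - {k}) = card (UNIV :: 'n set)"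
      using card by simp
    then obtain \<sigma> :: "'m \<Rightarrow> 'n" where "bij_betw \<sigma> (UNIV - {k}) UNIV"
      using finite_same_card_bij[of "UNIV - {k}" "UNIV :: 'n set"] by auto
    then have \<sigma>: "\<exists>i. i \<noteq> k \<and> \<sigma> i = j" for j
      unfolding bij_betw_def by (metis DiffD2 UNIV_I imageE singletonI)
    define M where "M y = (\<chi> i. if i = k then \<nu> (param \<kappa> y) else e y (\<sigma> i))" for y
    define c where "c y = (\<chi> i. if i = k then \<phi> (param \<kappa> y) \<bullet> \<nu> (param \<kappa> y) else a y $ \<sigma> i)" for y
    have \<nu>S: "smooth_on ?S (\<lambda>y. \<nu> (param \<kappa> y))"
      by (rule smooth_on_subset[OF chart_smoothD[OF chart_smooth_\<nu> \<kappa>]]) (use U(3) in blast)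
    have \<phi>S: "smooth_on ?S (\<lambda>y. \<phi> (param \<kappa> y))"
      by (rule smooth_on_subset[OF chart_smoothD[OF \<phi> \<kappa>]]) (use U(3) in blast)
    have "smooth_on ?S (\<lambda>y. f (param \<kappa> y))"
    proof (rule smooth_on_linear_solution[OF S])
      fix i
      show "smooth_on ?S (\<lambda>y. M y $ i)"
        using \<nu>S e by (cases "i = k") (simp_all add: M_def)
      show "smooth_on ?S (\<lambda>y. c y $ i)"
        using smooth_on_inner[OF S \<phi>S \<nu>S] smooth_on_nth[OF S a] by (cases "i = k") (simp_all add: c_def)
    next
      fix y assume y: "y \<in> ?S"
      show "M y *v f (param \<kappa> y) = c y"
      proof (rule vec_eq_iff[THEN iffD2], rule allI)
        fix i
        have "e y (\<sigma> i) \<in> sphere_tangent (\<nu> (param \<kappa> y))"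
          using tang[OF y] by (simp add: sphere_tangent_def e_def)
        then show "(M y *v f (param \<kappa> y)) $ i = c y $ i"
          using f\<omega>[OF top[OF y]] f\<nu>[OF top[OF y]]
          by (simp add: matrix_vector_mul_component M_def c_def a_def inner_commute)
      qed
    next
      \<comment> \<open>A vector in the kernel is orthogonal to \<open>\<nu>\<close> and to all
        coordinate vectors. By linearity it is orthogonal to the whole range of the derivative of
        the parametrization, which has dimension n.\<close>
      fix y u assume y: "y \<in> ?S" and u: "M y *v u = 0"
      have Mu: "M y $ i \<bullet> u = 0" for i
        unfolding matrix_vector_mul_component[symmetric] u by simp
      let ?L = "frechet_derivative (param \<beta>) (at (b y))"
      have lin: "linear ?L"
        by (rule has_derivative_linear[OF smooth_on_has_derivative[OF sphere_chart(4)[OF \<beta>(1)] by_in[OF y]]])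
      have ue: "u \<bullet> e y j = 0" for j
      proof -
        obtain i where "i \<noteq> k" "\<sigma> i = j"
          using \<sigma> by blast
        then show ?thesis
          using Mu[of i] by (simp add: M_def inner_commute)
      qed
      have "u \<bullet> ?L w = 0" for w
      proof -
        have "?L w = ?L (\<Sum>i\<in>UNIV. w $ i *\<^sub>R axis i 1)"
          by (simp only: scalar_mult_eq_scaleR[symmetric] basis_expansion)
        also have "\<dots> = (\<Sum>i\<in>UNIV. w $ i *\<^sub>R e y i)"
          by (simp only: linear_sum[OF lin] linear_scale[OF lin] e_def)
        finally show ?thesis
          by (simp add: inner_sum_right ue)
      qed
      moreover have "u \<bullet> \<nu> (param \<kappa> y) = 0"
        using Mu[of k] by (simp add: M_def inner_commute)
      ultimately show "u = 0"
        by (intro orthogonal_to_hyperplane_and_normal[OF card sphere_chart_dim[OF \<beta>(1) by_in[OF y]]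
              n1[OF top[OF y]] tang[OF y]])
    qed
    then show "\<exists>\<kappa>\<in>A. \<exists>U. openin X U \<and> x \<in> U \<and> U \<subseteq> dom_of \<kappa> \<and> smooth_on (coord \<kappa> ` U) (\<lambda>y. f (param \<kappa> y))"
      using \<kappa> U by blast
  qed
  moreover have "chart_deriv \<kappa> (\<lambda>x. \<phi> x \<bullet> \<nu> x) x w = f x \<bullet> chart_deriv \<kappa> \<nu> x w"
    if "\<kappa> \<in> A" "x \<in> dom_of \<kappa>" for \<kappa> x w
    unfolding D[OF that]
    by (rule f\<omega>[symmetric, OF dom_topspace[OF that]])
      (simp add: sphere_tangent_def chart_deriv_\<nu>_orthogonal[OF that])
  moreover have "f \<in> extensional (topspace X)"
    by (simp add: f_def)
  ultimately have "is_envelope X A \<phi> \<nu> f"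
    unfolding is_envelope_iff using f\<nu> by blast
  then show ?thesis
    by blast
qed

end

theorem theorem2:
  fixes n :: nat
    and N :: "'a topology"
    and A :: "('a, real^'n) chart set"
    and \<phi> \<nu> :: "'a \<Rightarrow> real^'m"
  assumes "n \<ge> 1" and "CARD('n) = n" and "CARD('m) = n + 1"
    and "smooth_manifold N A"
    and "smooth_map N A std_atlas \<phi>"
    and "\<forall>x\<in>topspace N. \<nu> x \<in> sphere 0 1"
    and "smooth_map N A (sphere_atlas :: (real^'m, real^'n) chart set) \<nu>"
  shows "creates_unique_envelope N A \<phi> \<nu> \<longleftrightarrow>
    creative N A \<phi> \<nu> \<and> N closure_of {x \<in> topspace N. regular_point A \<nu> x} = topspace N"
proof -
  have m: "CARD('m) = CARD('n) + 1"
    using assms(2,3) by simp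
  have \<phi>: "chart_smooth A \<phi>"
    using assms(5) unfolding smooth_map_std_iff[OF assms(4)] chart_smooth_def .
  have u: "norm (\<nu> x) = 1" if "x \<in> topspace N" for x
    using assms(6) that by simp
  note ctx = assms(4) \<phi> assms(7) u m
  show ?thesis
    unfolding creates_unique_envelope_def
  proof
    assume "\<exists>!f. is_envelope N A \<phi> \<nu> f"
    then obtain f where f: "is_envelope N A \<phi> \<nu> f" "\<And>g. is_envelope N A \<phi> \<nu> g \<Longrightarrow> g = f"
      by blast
    show "creative N A \<phi> \<nu> \<and> N closure_of {x \<in> topspace N. regular_point A \<nu> x} = topspace N"
      by (intro conjI envelope_imp_creative[OF ctx f(1)] envelope_unique_imp_dense[OF ctx f])
  next
    assume *: "creative N A \<phi> \<nu> \<and> N closure_of {x \<in> topspace N. regular_point A \<nu> x} = topspace N"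
    obtain f where f: "is_envelope N A \<phi> \<nu> f"
      using creative_imp_envelope[OF ctx] * by blast
    show "\<exists>!f. is_envelope N A \<phi> \<nu> f"
    proof (rule ex1I)
      show "is_envelope N A \<phi> \<nu> f"
        by (rule f)
      show "g = f" if "is_envelope N A \<phi> \<nu> g" for g
        by (rule dense_imp_envelope_unique[OF ctx conjunct2[OF *] that f])
    qed
  qed
qed

end
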